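(* The group $E_{6(6),\mathbb H'}=\{\alpha\in \mathrm{Iso}_{\mathbb R}(\mathfrak J(3,\mathbb H')) \mid \det(\alpha X)=\det X \text{ for all } X\}$ is isomorphic to the semi-direct product $$E_{6(6),\mathbb H'}\cong SL(6,\mathbb R)/\mathbb Z_2\rtimes\mathbb Z_2,$$ where the first $\mathbb Z_2$ is $\{E,-E\}$, the second is $\{1,\nu\}$ (a group of order two), and $\nu$ acts on $SL(6,\mathbb R)$ by $\nu A=I_iAI_i^{-1}$ with $I_i=\mathrm{diag}(-i,i,i,i,i,i)$ (descending to the quotient by $\{E,-E\}$).
   Context: $\mathbb C'=\mathbb R\oplus\mathbb R\mathbf i'$, $\mathbf i'^2=1$, is the algebra of split complex numbers, with conjugation $\overline{x+y\mathbf i'}=x-y\mathbf i'$. $\mathbb H'=\mathbb C'\oplus\mathbb C'\mathbf j$, $\mathbf j^2=-1$, $\mathbf ja=\overline a\,\mathbf j$ for $a\in\mathbb C'$, is the algebra of split quaternions, with conjugation $\overline{a+b\mathbf j}=\overline a-b\mathbf j$. $\mathfrak J(3,\mathbb H')=\{X\in M(3,\mathbb H')\mid X^*=X\}$ ($X^*={}^t\overline X$), whose elements are $X=\begin{pmatrix}\xi_1&x_3&\overline x_2\\ \overline x_3&\xi_2&x_1\\ x_2&\overline x_1&\xi_3\end{pmatrix}$, $\xi_i\in\mathbb R$, $x_i\in\mathbb H'$, and $\det X:=\xi_1\xi_2\xi_3+x_1x_2x_3+\overline{x_1x_2x_3}-\sum_i\xi_ix_i\overline x_i\in\mathbb R$.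 $\mathrm{Iso}_{\mathbb R}(V)$ is the group of $\mathbb R$-linear automorphisms of $V$. Here $i\in C$ is the usual imaginary unit and $I_i\in SL(6,C)$, $C=\mathbb R\oplus\mathbb Ri$; conjugation by $I_i$ preserves $SL(6,\mathbb R)$. *)

theory Defs
  imports "HOL-Analysis.Analysis" "HOL-Algebra.Bij" "HOL-Algebra.Elementary_Groups"
begin

section \<open>Split complex numbers and split quaternions\<close>

datatype split_complex = SC (sre: real) (sim: real)

lemma split_complex_eq_iff: "x = y \<longleftrightarrow> sre x = sre y \<and> sim x = sim y"
  by (auto intro: split_complex.expand)

instantiation split_complex :: comm_ring_1
begin

definition "0 = SC 0 0"
definition "1 = SC 1 0"
definition "x + y = SC (sre x + sre y) (sim x + sim y)"
definition "x - y = SC (sre x - sre y) (sim x - sim y)"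
definition "- x = SC (- sre x) (- sim x)"
definition "x * y = SC (sre x * sre y + sim x * sim y) (sre x * sim y + sim x * sre y)"

lemma split_complex_sel [simp]:
  "sre 0 = 0" "sim 0 = 0" "sre 1 = 1" "sim 1 = 0"
  "sre (x + y) = sre x + sre y" "sim (x + y) = sim x + sim y"
  "sre (x - y) = sre x - sre y" "sim (x - y) = sim x - sim y"
  "sre (- x) = - sre x" "sim (- x) = - sim x"
  "sre (x * y) = sre x * sre y + sim x * sim y"
  "sim (x * y) = sre x * sim y + sim x * sre y"
  by (simp_all add: zero_split_complex_def one_split_complex_def plus_split_complex_def
      minus_split_complex_def uminus_split_complex_def times_split_complex_def)

instance
  by standard (simp_all add: split_complex_eq_iff algebra_simps)

end

instantiation split_complex :: real_algebra_1
begin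

definition "r *\<^sub>R x = SC (r * sre x) (r * sim x)"

lemma split_complex_scaleR_sel [simp]:
  "sre (r *\<^sub>R x) = r * sre x" "sim (r *\<^sub>R x) = r * sim x"
  by (simp_all add: scaleR_split_complex_def)

instance
  by standard (simp_all add: split_complex_eq_iff algebra_simps)

end

definition sc_cnj :: "split_complex \<Rightarrow> split_complex"
  where "sc_cnj x = SC (sre x) (- sim x)"

lemma sc_cnj_sel [simp]: "sre (sc_cnj x) = sre x" "sim (sc_cnj x) = - sim x"
  by (simp_all add: sc_cnj_def)

lemma sc_cnj_simps [simp]:
  "sc_cnj 0 = 0" "sc_cnj 1 = 1" "sc_cnj (sc_cnj x) = x"
  "sc_cnj (x + y) = sc_cnj x + sc_cnj y" "sc_cnj (x - y) = sc_cnj x - sc_cnj y"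
  "sc_cnj (- x) = - sc_cnj x" "sc_cnj (x * y) = sc_cnj x * sc_cnj y"
  "sc_cnj (r *\<^sub>R x) = r *\<^sub>R sc_cnj x"
  by (simp_all add: split_complex_eq_iff)

text \<open>\<open>SQ a b\<close> stands for \<open>a + b j\<close>. The product is determined by \<open>j a = sc_cnj a j\<close> and \<open>j\<^sup>2 = -1\<close>;
  see \<open>split_quat_basis\<close>.\<close>

datatype split_quat = SQ (sq1: split_complex) (sq2: split_complex)

lemma split_quat_eq_iff: "x = y \<longleftrightarrow> sq1 x = sq1 y \<and> sq2 x = sq2 y"
  by (auto intro: split_quat.expand)

instantiation split_quat :: ring_1
begin

definition "0 = SQ 0 0"
definition "1 = SQ 1 0"
definition "x + y = SQ (sq1 x + sq1 y) (sq2 x + sq2 y)"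
definition "x - y = SQ (sq1 x - sq1 y) (sq2 x - sq2 y)"
definition "- x = SQ (- sq1 x) (- sq2 x)"
definition "x * y = SQ (sq1 x * sq1 y - sq2 x * sc_cnj (sq2 y))
                       (sq1 x * sq2 y + sq2 x * sc_cnj (sq1 y))"

lemma split_quat_sel [simp]:
  "sq1 0 = 0" "sq2 0 = 0" "sq1 1 = 1" "sq2 1 = 0"
  "sq1 (x + y) = sq1 x + sq1 y" "sq2 (x + y) = sq2 x + sq2 y"
  "sq1 (x - y) = sq1 x - sq1 y" "sq2 (x - y) = sq2 x - sq2 y"
  "sq1 (- x) = - sq1 x" "sq2 (- x) = - sq2 x"
  "sq1 (x * y) = sq1 x * sq1 y - sq2 x * sc_cnj (sq2 y)"
  "sq2 (x * y) = sq1 x * sq2 y + sq2 x * sc_cnj (sq1 y)"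
  by (simp_all add: zero_split_quat_def one_split_quat_def plus_split_quat_def
      minus_split_quat_def uminus_split_quat_def times_split_quat_def)

instance
  by standard (simp_all add: split_quat_eq_iff algebra_simps)

end

instantiation split_quat :: real_algebra_1
begin

definition "r *\<^sub>R x = SQ (r *\<^sub>R sq1 x) (r *\<^sub>R sq2 x)"

lemma split_quat_scaleR_sel [simp]:
  "sq1 (r *\<^sub>R x) = r *\<^sub>R sq1 x" "sq2 (r *\<^sub>R x) = r *\<^sub>R sq2 x"
  by (simp_all add: scaleR_split_quat_def)

instance
  by standard (simp_all add: split_quat_eq_iff algebra_simps)

end

lemma split_quat_basis:
  "SQ a b = SQ a 0 + SQ b 0 * SQ 0 1"
  "SQ (a + c) 0 = SQ a 0 + SQ c 0"
  "SQ (a * c) 0 = SQ a 0 * SQ c 0"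
  "SQ 0 1 * SQ 0 1 = (- 1 :: split_quat)"
  "SQ 0 1 * SQ a 0 = SQ (sc_cnj a) 0 * SQ 0 1"
  "SC 0 1 * SC 0 1 = (1 :: split_complex)"
  by (simp_all add: split_quat_eq_iff split_complex_eq_iff)

definition sq_cnj :: "split_quat \<Rightarrow> split_quat"
  where "sq_cnj x = SQ (sc_cnj (sq1 x)) (- sq2 x)"

lemma sq_cnj_sel [simp]: "sq1 (sq_cnj x) = sc_cnj (sq1 x)" "sq2 (sq_cnj x) = - sq2 x"
  by (simp_all add: sq_cnj_def)

lemma sq_cnj_simps [simp]:
  "sq_cnj 0 = 0" "sq_cnj (sq_cnj x) = x"
  "sq_cnj (x + y) = sq_cnj x + sq_cnj y" "sq_cnj (r *\<^sub>R x) = r *\<^sub>R sq_cnj x"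
  by (simp_all add: split_quat_eq_iff)

lemma sq_cnj_mult: "sq_cnj (x * y) = sq_cnj y * sq_cnj x"
  by (simp add: split_quat_eq_iff algebra_simps)

lemma split_quat_Reals_iff: "x \<in> \<real> \<longleftrightarrow> sim (sq1 x) = 0 \<and> sq2 x = 0"
proof
  show "x \<in> \<real> \<Longrightarrow> sim (sq1 x) = 0 \<and> sq2 x = 0"
    by (auto simp: Reals_def of_real_def split_complex_eq_iff)
next
  assume "sim (sq1 x) = 0 \<and> sq2 x = 0"
  then have "x = of_real (sre (sq1 x))"
    by (simp add: of_real_def split_quat_eq_iff split_complex_eq_iff)
  then show "x \<in> \<real>"
    by (metis Reals_of_real)
qed

lemma sq_cnj_eq_iff_Reals: "sq_cnj x = x \<longleftrightarrow> x \<in> \<real>"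
  by (auto simp: split_quat_Reals_iff split_quat_eq_iff split_complex_eq_iff)


section \<open>Hermitian matrices over the split quaternions\<close>

definition adjoint_sq :: "split_quat^'n^'m \<Rightarrow> split_quat^'m^'n"
  where "adjoint_sq X = transpose (map_matrix sq_cnj X)"

definition J3 :: "(split_quat^3^3) set"
  where "J3 = {X. adjoint_sq X = X}"

text \<open>The real diagonal entries and the parameters \<open>x\<^sub>1, x\<^sub>2, x\<^sub>3\<close> of \<open>X \<in> J3\<close> are the matrix
  entries displayed in \<open>J3_iff\<close>. The determinant is an element of the split quaternions
  which is real for \<open>X \<in> J3\<close> by \<open>det_J3_real\<close>.\<close>

definition det_J3 :: "split_quat^3^3 \<Rightarrow> split_quat"
  where "det_J3 X =
    (let \<xi>1 = X$1$1; \<xi>2 = X$2$2; \<xi>3 = X$3$3; x1 = X$2$3; x2 = X$3$1; x3 = X$1$2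
     in \<xi>1 * \<xi>2 * \<xi>3 + x1 * x2 * x3 + sq_cnj (x1 * x2 * x3)
        - (\<xi>1 * x1 * sq_cnj x1 + \<xi>2 * x2 * sq_cnj x2 + \<xi>3 * x3 * sq_cnj x3))"

lemma J3_iff:
  "X \<in> J3 \<longleftrightarrow> (\<exists>\<xi>1 \<xi>2 \<xi>3 :: real. \<exists>x1 x2 x3.
     X = vector [vector [of_real \<xi>1, x3, sq_cnj x2],
                 vector [sq_cnj x3, of_real \<xi>2, x1],
                 vector [x2, sq_cnj x1, of_real \<xi>3]])" (is "_ \<longleftrightarrow> ?R")
proof -
  have real: "sq_cnj (of_real r) = of_real r" for r
    by (simp add: sq_cnj_eq_iff_Reals)
  show ?thesis
  proof
    assume "X \<in> J3"
    then have h: "sq_cnj (X$j$i) = X$i$j" for i j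
      by (simp add: J3_def adjoint_sq_def transpose_def vec_eq_iff)
    obtain r1 r2 r3 where r: "X$1$1 = of_real r1" "X$2$2 = of_real r2" "X$3$3 = of_real r3"
      by (metis h Reals_cases sq_cnj_eq_iff_Reals)
    have "X = vector [vector [of_real r1, X$1$2, sq_cnj (X$3$1)],
                 vector [sq_cnj (X$1$2), of_real r2, X$2$3],
                 vector [X$3$1, sq_cnj (X$2$3), of_real r3]]"
      by (simp add: vec_eq_iff forall_3 vector_3 h r)
    then show ?R
      by blast
  next
    assume ?R
    then show "X \<in> J3"
      by (auto simp: J3_def adjoint_sq_def transpose_def vec_eq_iff forall_3 real)
  qed
qed

lemma det_J3_real:
  assumes "X \<in> J3" shows "det_J3 X \<in> \<real>"
proof -
  have 1: "x + sq_cnj x \<in> \<real>" "x * sq_cnj x \<in> \<real>" for x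
    by (simp_all add: sq_cnj_mult flip: sq_cnj_eq_iff_Reals)
  have "X$i$i \<in> \<real>" for i
    using assms
    by (simp add: J3_def adjoint_sq_def transpose_def vec_eq_iff flip: sq_cnj_eq_iff_Reals)
  then show ?thesis
    unfolding det_J3_def Let_def add.assoc mult.assoc
    by (intro Reals_add Reals_diff Reals_mult 1)
qed

lemma subspace_J3: "subspace J3"
  by (auto simp: subspace_def J3_def adjoint_sq_def transpose_def vec_eq_iff)


section \<open>The group of determinant-preserving linear automorphisms\<close>

text \<open>Real-linear automorphisms of a subspace \<open>V\<close>, represented as extensional functions on \<open>V\<close>.\<close>

definition Iso_real :: "'a::real_vector set \<Rightarrow> ('a \<Rightarrow> 'a) monoid"
  where "Iso_real V = BijGroup V
    \<lparr>carrier := {\<alpha> \<in> Bij V. (\<forall>x\<in>V. \<forall>y\<in>V. \<alpha> (x + y) = \<alpha> x + \<alpha> y)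
                            \<and> (\<forall>r. \<forall>x\<in>V. \<alpha> (r *\<^sub>R x) = r *\<^sub>R \<alpha> x)}\<rparr>"

definition E6_split :: "(split_quat^3^3 \<Rightarrow> split_quat^3^3) monoid"
  where "E6_split = Iso_real J3
    \<lparr>carrier := {\<alpha> \<in> carrier (Iso_real J3). \<forall>X\<in>J3. det_J3 (\<alpha> X) = det_J3 X}\<rparr>"

lemma subgroup_Iso_real:
  assumes V: "subspace V"
  shows "subgroup (carrier (Iso_real V)) (BijGroup V)"
proof (rule group.subgroupI[OF group_BijGroup])
  show "carrier (Iso_real V) \<subseteq> carrier (BijGroup V)"
    by (auto simp: Iso_real_def BijGroup_def)
  have "(\<lambda>x\<in>V. x) \<in> carrier (Iso_real V)"
    using V by (auto simp: Iso_real_def id_Bij subspace_add subspace_scale)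
  then show "carrier (Iso_real V) \<noteq> {}"
    by blast
next
  fix f assume f: "f \<in> carrier (Iso_real V)"
  let ?g = "inv_into V f"
  have fB: "f \<in> Bij V" and add: "\<And>x y. x \<in> V \<Longrightarrow> y \<in> V \<Longrightarrow> f (x + y) = f x + f y"
    and scale: "\<And>r x. x \<in> V \<Longrightarrow> f (r *\<^sub>R x) = r *\<^sub>R f x"
    using f by (auto simp: Iso_real_def)
  have inj: "inj_on f V" and im: "f ` V = V"
    using fB by (auto simp: Bij_def bij_betw_def)
  have g: "?g x \<in> V" "f (?g x) = x" if "x \<in> V" for x
    using that im by (auto simp: inv_into_into f_inv_into_f)
  have "?g (x + y) = ?g x + ?g y" if "x \<in> V" "y \<in> V" for x y
    using that g V by (intro inv_into_f_eq inj) (auto simp: add subspace_add)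
  moreover have "?g (r *\<^sub>R x) = r *\<^sub>R ?g x" if "x \<in> V" for r x
    using that g V by (intro inv_into_f_eq inj) (auto simp: scale subspace_scale)
  ultimately show "inv\<^bsub>BijGroup V\<^esub> f \<in> carrier (Iso_real V)"
    using V restrict_inv_into_Bij[OF fB]
    by (auto simp: inv_BijGroup fB Iso_real_def subspace_add subspace_scale)
next
  fix f g assume *: "f \<in> carrier (Iso_real V)" "g \<in> carrier (Iso_real V)"
  then have "f \<in> Bij V" "g \<in> Bij V" "\<And>x. x \<in> V \<Longrightarrow> g x \<in> V"
    by (auto simp: Iso_real_def dest: Bij_imp_funcset)
  with * V show "f \<otimes>\<^bsub>BijGroup V\<^esub> g \<in> carrier (Iso_real V)"
    by (auto simp: Iso_real_def BijGroup_def compose_Bij compose_eq subspace_add subspace_scale)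
qed

lemma group_Iso_real: "subspace V \<Longrightarrow> group (Iso_real V)"
  using subgroup.subgroup_is_group[OF subgroup_Iso_real group_BijGroup, of V]
  by (simp add: Iso_real_def)

lemma group_E6_split: "group E6_split"
proof -
  let ?I = "Iso_real J3"
  interpret I: group ?I
    by (rule group_Iso_real[OF subspace_J3])
  have inB: "f \<in> Bij J3" if "f \<in> carrier ?I" for f
    using that by (auto simp: Iso_real_def)
  have m: "f \<otimes>\<^bsub>?I\<^esub> g = compose J3 f g" if "f \<in> carrier ?I" "g \<in> carrier ?I" for f g
    using inB[OF that(1)] inB[OF that(2)] by (simp add: Iso_real_def BijGroup_def)
  have o: "\<one>\<^bsub>?I\<^esub> = (\<lambda>x\<in>J3. x)"
    by (simp add: Iso_real_def BijGroup_def)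
  have mem: "f x \<in> J3" if "f \<in> carrier ?I" "x \<in> J3" for f x
    using Bij_imp_funcset[OF inB[OF that(1)]] that by blast
  have "subgroup {\<alpha> \<in> carrier ?I. \<forall>X\<in>J3. det_J3 (\<alpha> X) = det_J3 X} ?I"
  proof (rule I.subgroupI)
    show "{\<alpha> \<in> carrier ?I. \<forall>X\<in>J3. det_J3 (\<alpha> X) = det_J3 X} \<noteq> {}"
      using I.one_closed o by (auto intro!: exI[of _ "\<one>\<^bsub>?I\<^esub>"])
  next
    fix f assume f: "f \<in> {\<alpha> \<in> carrier ?I. \<forall>X\<in>J3. det_J3 (\<alpha> X) = det_J3 X}"
    have "det_J3 ((inv\<^bsub>?I\<^esub> f) X) = det_J3 X" if X: "X \<in> J3" for X
    proof -
      have "compose J3 f (inv\<^bsub>?I\<^esub> f) = (\<lambda>x\<in>J3. x)"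
        using f I.r_inv[of f] m[of f "inv\<^bsub>?I\<^esub> f"] o by simp
      then have "compose J3 f (inv\<^bsub>?I\<^esub> f) X = X"
        using X by simp
      then have "f ((inv\<^bsub>?I\<^esub> f) X) = X"
        using X by (simp add: compose_eq)
      moreover have "det_J3 (f ((inv\<^bsub>?I\<^esub> f) X)) = det_J3 ((inv\<^bsub>?I\<^esub> f) X)"
        using f X mem[of "inv\<^bsub>?I\<^esub> f" X] by simp
      ultimately show ?thesis
        by simp
    qed
    then show "inv\<^bsub>?I\<^esub> f \<in> {\<alpha> \<in> carrier ?I. \<forall>X\<in>J3. det_J3 (\<alpha> X) = det_J3 X}"
      using f by auto
  next
    fix f g assume "f \<in> {\<alpha> \<in> carrier ?I. \<forall>X\<in>J3. det_J3 (\<alpha> X) = det_J3 X}"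
      "g \<in> {\<alpha> \<in> carrier ?I. \<forall>X\<in>J3. det_J3 (\<alpha> X) = det_J3 X}"
    then show "f \<otimes>\<^bsub>?I\<^esub> g \<in> {\<alpha> \<in> carrier ?I. \<forall>X\<in>J3. det_J3 (\<alpha> X) = det_J3 X}"
      using I.m_closed[of f g] by (auto simp: m compose_eq mem)
  qed auto
  then show ?thesis
    unfolding E6_split_def by (rule subgroup.subgroup_is_group[OF _ I.is_group])
qed


section \<open>Semidirect products and the special linear group\<close>

definition semidirect_product ::
    "('a, 'c) monoid_scheme \<Rightarrow> ('b, 'd) monoid_scheme \<Rightarrow> ('b \<Rightarrow> 'a \<Rightarrow> 'a) \<Rightarrow> ('a \<times> 'b) monoid"
  where "semidirect_product N H \<phi> =
    \<lparr>carrier = carrier N \<times> carrier H,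
     mult = (\<lambda>(n, h) (n', h'). (n \<otimes>\<^bsub>N\<^esub> \<phi> h n', h \<otimes>\<^bsub>H\<^esub> h')),
     one = (\<one>\<^bsub>N\<^esub>, \<one>\<^bsub>H\<^esub>)\<rparr>"

lemma group_semidirect_product:
  assumes N: "group N" and H: "group H" and \<phi>: "\<phi> \<in> hom H (AutoGroup N)"
  shows "group (semidirect_product N H \<phi>)"
proof -
  interpret N: group N by fact
  interpret H: group H by fact
  interpret A: group "AutoGroup N" by (rule N.AutoGroup)
  interpret \<phi>: group_hom H "AutoGroup N" \<phi>
    by unfold_locales (rule \<phi>)
  have au: "\<phi> h \<in> auto N" if "h \<in> carrier H" for h
    using \<phi>.hom_closed[OF that] by (simp add: AutoGroup_def)
  have cl: "\<phi> h n \<in> carrier N" if "h \<in> carrier H" "n \<in> carrier N" for h n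
    using au[OF that(1)] that(2) by (auto simp: auto_def hom_def)
  have mu: "\<phi> h (m \<otimes>\<^bsub>N\<^esub> n) = \<phi> h m \<otimes>\<^bsub>N\<^esub> \<phi> h n"
    if "h \<in> carrier H" "n \<in> carrier N" "m \<in> carrier N" for h m n
    using au[OF that(1)] that(2,3) by (auto simp: auto_def hom_def)
  have one: "\<phi> \<one>\<^bsub>H\<^esub> n = n" if "n \<in> carrier N" for n
    using \<phi>.hom_one that by (simp add: AutoGroup_def BijGroup_def)
  have comp: "\<phi> (h \<otimes>\<^bsub>H\<^esub> k) n = \<phi> h (\<phi> k n)"
    if "h \<in> carrier H" "k \<in> carrier H" "n \<in> carrier N" for h k n
    using \<phi>.hom_mult[OF that(1,2)] that au[OF that(1)] au[OF that(2)]
    by (simp add: AutoGroup_def BijGroup_def auto_def compose_eq)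
  show ?thesis
  proof (rule groupI, goal_cases)
    case (5 x)
    then obtain n h where x: "x = (n, h)" "n \<in> carrier N" "h \<in> carrier H"
      by (auto simp: semidirect_product_def)
    let ?h = "inv\<^bsub>H\<^esub> h" and ?n = "inv\<^bsub>N\<^esub> (\<phi> (inv\<^bsub>H\<^esub> h) n)"
    have "?n \<in> carrier N"
      using x cl by (intro N.inv_closed) blast
    then have "(?n, ?h) \<in> carrier (semidirect_product N H \<phi>)"
      using x by (simp add: semidirect_product_def)
    moreover have "?n \<otimes>\<^bsub>N\<^esub> \<phi> ?h n = \<one>\<^bsub>N\<^esub>"
      using x cl by (intro N.l_inv) blast
    then have "(?n, ?h) \<otimes>\<^bsub>semidirect_product N H \<phi>\<^esub> x = \<one>\<^bsub>semidirect_product N H \<phi>\<^esub>"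
      using x by (simp add: semidirect_product_def del: \<phi>.hom_inv)
    ultimately show ?case
      by blast
  qed (auto simp: semidirect_product_def cl mu one comp N.m_assoc H.m_assoc
      simp del: \<phi>.hom_mult \<phi>.hom_one)
qed

definition SL :: "('a::field^'n^'n) monoid"
  where "SL = \<lparr>carrier = {A. det A = 1}, mult = (**), one = mat 1\<rparr>"

lemma group_SL: "group (SL :: ('a::field^'n^'n) monoid)"
proof (rule groupI, goal_cases)
  case (5 A)
  then have "invertible A"
    by (simp add: SL_def invertible_det_nz)
  then obtain B where B: "B ** A = mat 1"
    by (auto simp: invertible_def)
  then have "det B * det A = 1"
    by (metis det_I det_mul)
  with 5 B show ?case
    by (auto simp: SL_def intro!: exI[of _ B])
qed (auto simp: SL_def det_mul matrix_mul_assoc)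

definition pm_one :: "(real^6^6) set"
  where "pm_one = {mat 1, - mat 1}"

definition I_i :: "complex^6^6"
  where "I_i = (\<chi> j k. if j = k then (if j = 1 then - \<i> else \<i>) else 0)"

text \<open>The map \<open>A \<mapsto> I_i A I_i\<^sup>-\<^sup>1\<close>. Taking real parts only identifies a complex matrix with
  real entries with a real matrix; see \<open>of_real_nu\<close>.\<close>

definition nu :: "real^6^6 \<Rightarrow> real^6^6"
  where "nu A = map_matrix Re (I_i ** map_matrix of_real A ** matrix_inv I_i)"

text \<open>The group \<open>{1, \<nu>}\<close> is \<open>integer_mod_group 2\<close>, with \<open>\<nu>\<close> corresponding to the residue \<open>1\<close>.
  Elements of the quotient are cosets, on which \<open>\<nu>\<close> acts by taking images.\<close>

definition nu_action :: "int \<Rightarrow> (real^6^6) set \<Rightarrow> (real^6^6) set"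
  where "nu_action k = (\<lambda>C\<in>carrier (SL Mod pm_one). if k = 0 then C else nu ` C)"

lemma I_i_mult_minus: "I_i ** (- I_i) = mat 1" "(- I_i) ** I_i = mat 1"
  by (simp_all add: I_i_def matrix_matrix_mult_def vec_eq_iff mat_def if_distrib[of "\<lambda>x. x * _"]
      if_distrib[of "\<lambda>x. - x"] sum.delta cong: if_cong)

lemma matrix_inv_I_i: "matrix_inv I_i = - I_i"
proof -
  have "I_i ** matrix_inv I_i = mat 1"
    unfolding matrix_inv_def by (rule someI2[of _ "- I_i"]) (simp_all add: I_i_mult_minus)
  then have "(- I_i) ** (I_i ** matrix_inv I_i) = - I_i"
    by simp
  then show ?thesis
    by (simp add: matrix_mul_assoc I_i_mult_minus)
qed

lemma conj_I_i_nth: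
  "(I_i ** B ** matrix_inv I_i) $ j $ k = (if (j = 1) = (k = 1) then B $ j $ k else - B $ j $ k)"
proof -
  have l: "(I_i ** B) $ j $ k = (if j = 1 then - \<i> else \<i>) * B $ j $ k" for B :: "complex^6^6" and j k
    by (simp add: I_i_def matrix_matrix_mult_def if_distrib[of "\<lambda>x. x * _"] cong: if_cong)
  have r: "(B ** (- I_i)) $ j $ k = - (B $ j $ k * (if k = 1 then - \<i> else \<i>))"
    for B :: "complex^6^6" and j k
    by (simp add: I_i_def matrix_matrix_mult_def if_distrib[of "\<lambda>x. _ * x"]
        if_distrib[of "\<lambda>x. - x"] cong: if_cong)
  show ?thesis
    by (simp add: matrix_inv_I_i l r mult.commute[of "\<i> * _"] flip: mult.assoc)
qed

lemma of_real_nu: "map_matrix of_real (nu A) = I_i ** map_matrix of_real A ** matrix_inv I_i"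
  by (simp add: nu_def vec_eq_iff conj_I_i_nth)

lemma nu_nth: "nu A $ j $ k = (if (j = 1) = (k = 1) then A $ j $ k else - A $ j $ k)"
  by (simp add: nu_def conj_I_i_nth)

lemma nu_nu: "nu (nu A) = A"
  by (simp add: vec_eq_iff nu_nth)

lemma nu_mult: "nu (A ** B) = nu A ** nu B"
proof -
  have "nu A $ j $ l * nu B $ l $ k
      = (if (j = 1) = (k = 1) then A $ j $ l * B $ l $ k else - (A $ j $ l * B $ l $ k))" for j k l
    by (auto simp: nu_nth)
  then show ?thesis
    by (simp add: vec_eq_iff matrix_matrix_mult_def nu_nth sum_negf)
qed

lemma nu_pm_one: "nu ` pm_one = pm_one"
proof -
  have "nu (mat 1) = mat 1" "nu (- mat 1) = - mat 1"
    by (auto simp: vec_eq_iff nu_nth mat_def)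
  then show ?thesis
    by (simp add: pm_one_def)
qed

lemma det_nu: "det (nu A) = det A"
proof -
  define D :: "real^6^6" where "D = (\<chi> j k. if j = k then (if j = 1 then - 1 else 1) else 0)"
  have D: "D $ j $ k = (if j = k then (if j = 1 then - 1 else 1) else 0)" for j k
    by (simp add: D_def)
  have l: "(D ** B) $ j $ k = (if j = 1 then - 1 else 1) * B $ j $ k" for B :: "real^6^6" and j k
    by (simp add: D matrix_matrix_mult_def if_distrib[of "\<lambda>x. x * _"] cong: if_cong)
  have r: "(B ** D) $ j $ k = B $ j $ k * (if k = 1 then - 1 else 1)" for B :: "real^6^6" and j k
    by (simp add: D matrix_matrix_mult_def if_distrib[of "\<lambda>x. _ * x"] cong: if_cong)
  have "D ** D = mat 1" and nu: "nu A = D ** A ** D"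
    by (auto simp: vec_eq_iff nu_nth l r D mat_def)
  then have "det D * det D = 1"
    by (metis det_I det_mul)
  then show ?thesis
    by (simp add: nu det_mul)
qed

lemma normal_pm_one: "pm_one \<lhd> (SL :: (real^6^6) monoid)"
proof -
  let ?S = "SL :: (real^6^6) monoid"
  interpret S: group ?S
    by (rule group_SL)
  have neg: "det (- mat 1 :: real^6^6) = 1"
    by (subst det_diagonal) (simp_all add: mat_def)
  have mul: "(- mat 1) ** A = - A" "A ** (- mat 1) = - A" for A :: "real^6^6"
    by (simp_all add: vec_eq_iff matrix_matrix_mult_def mat_def if_distrib[of "\<lambda>x. x * _"]
        if_distrib[of "\<lambda>x. _ * x"] if_distrib[of "\<lambda>x. - x"] cong: if_cong)
  have sub: "pm_one \<subseteq> carrier ?S"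
    by (simp add: pm_one_def SL_def neg)
  have "subgroup pm_one ?S"
  proof (rule S.subgroupI[OF sub])
    fix a assume a: "a \<in> pm_one"
    then have "a \<otimes>\<^bsub>?S\<^esub> a = \<one>\<^bsub>?S\<^esub>"
      by (auto simp: pm_one_def SL_def mul)
    then have "inv\<^bsub>?S\<^esub> a = a"
      using a sub by (intro S.inv_equality) auto
    then show "inv\<^bsub>?S\<^esub> a \<in> pm_one"
      using a by simp
  qed (auto simp: pm_one_def SL_def mul)
  moreover have "x \<otimes>\<^bsub>?S\<^esub> h \<otimes>\<^bsub>?S\<^esub> inv\<^bsub>?S\<^esub> x \<in> pm_one" if "x \<in> carrier ?S" "h \<in> pm_one" for x h
  proof -
    have "x \<otimes>\<^bsub>?S\<^esub> h = h \<otimes>\<^bsub>?S\<^esub> x"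
      using that(2) by (auto simp: pm_one_def SL_def mul)
    moreover have "h \<in> carrier ?S"
      using that(2) sub by blast
    ultimately show ?thesis
      using that by (simp add: S.m_assoc)
  qed
  ultimately show ?thesis
    by (simp add: S.normal_inv_iff)
qed

lemma nu_action_hom: "nu_action \<in> hom (integer_mod_group 2) (AutoGroup (SL Mod pm_one))"
proof -
  let ?S = "SL :: (real^6^6) monoid" and ?Q = "SL Mod pm_one"
  interpret normal pm_one ?S
    by (rule normal_pm_one)
  have nu2: "nu ` nu ` C = C" for C
    by (simp add: image_image nu_nu)
  have closed: "nu ` C \<in> carrier ?Q" if C: "C \<in> carrier ?Q" for C
  proof -
    from C obtain a where a: "a \<in> carrier ?S" "C = pm_one #>\<^bsub>?S\<^esub> a"
      by (auto simp: FactGroup_def RCOSETS_def)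
    have "nu ` C = (\<Union>h\<in>nu ` pm_one. {h ** nu a})"
      by (simp add: a r_coset_def SL_def image_UN nu_mult)
    also have "\<dots> = pm_one #>\<^bsub>?S\<^esub> nu a"
      by (simp add: nu_pm_one r_coset_def SL_def)
    finally have "nu ` C = pm_one #>\<^bsub>?S\<^esub> nu a" .
    moreover have "nu a \<in> carrier ?S"
      using a(1) by (simp add: SL_def det_nu)
    ultimately show ?thesis
      by (auto simp: FactGroup_def RCOSETS_def)
  qed
  have mult: "nu ` (C <#>\<^bsub>?S\<^esub> D) = nu ` C <#>\<^bsub>?S\<^esub> nu ` D" for C D
    by (simp add: set_mult_def SL_def image_UN nu_mult)
  have Q: "group ?Q"
    by (rule factorgroup_is_group)
  have auto: "nu_action k \<in> auto ?Q" for k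
  proof -
    have "bij_betw (nu_action k) (carrier ?Q) (carrier ?Q)"
      by (rule bij_betwI[where g = "nu_action k"]) (auto simp: nu_action_def closed nu2)
    then show ?thesis
      using monoid.m_closed[OF group.is_monoid[OF Q]]
      by (auto simp: auto_def Bij_def hom_def nu_action_def closed mult)
  qed
  have "nu_action ((k + l) mod 2) = compose (carrier ?Q) (nu_action k) (nu_action l)"
    if "k \<in> {0..<2}" "l \<in> {0..<2}" for k l
  proof -
    have "k = 0 \<or> k = 1" "l = 0 \<or> l = 1"
      using that by auto
    then show ?thesis
      by (auto simp: nu_action_def compose_def closed nu2 fun_eq_iff)
  qed
  then show ?thesis
    using auto by (auto simp: hom_def AutoGroup_def BijGroup_def carrier_integer_mod_group auto_def)
qed

lemma group_semidirect_product_nu: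
  "group (semidirect_product (SL Mod pm_one) (integer_mod_group 2) nu_action)"
  using normal.factorgroup_is_group[OF normal_pm_one] nu_action_hom
  by (intro group_semidirect_product) simp_all

end

theory Submission
  imports Defs
begin

text \<open>Since the split quaternions are the real \<open>2 \<times> 2\<close> matrices, \<open>J3\<close> is identified with the
  skew-symmetric real \<open>6 \<times> 6\<close> matrices, that is, with bivectors of \<open>\<real>\<^sup>6\<close>, and the determinant becomes the
  Pfaffian. A linear bijection preserving the Pfaffian preserves the bivectors \<open>S\<close> with
  \<open>S \<and> S = 0\<close>, i.e. the decomposable ones \<open>x \<and> y\<close>. It maps the space of all \<open>e\<^sub>i \<and> y\<close> to a linear
  space of decomposable bivectors of dimension five, and such a space consists of multiples
  \<open>a \<and> z\<close> of a single vector. Hence the basis bivectors \<open>e\<^sub>i \<and> e\<^sub>j\<close> go to \<open>c\<^sub>i\<^sub>j a\<^sub>i \<and> a\<^sub>j\<close>, and invariance of the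
  Pfaffian forces \<open>c\<^sub>i\<^sub>j\<close> to be a constant times \<open>g\<^sub>i g\<^sub>j\<close>. So the group consists of the maps
  \<open>S \<mapsto> det B \<cdot> B S B\<^sup>T\<close> with \<open>det B = \<plusminus>1\<close>, where \<open>B\<close> is unique up to sign. As \<open>\<nu>\<close> is
  conjugation by \<open>D = diag(-1, 1, 1, 1, 1, 1)\<close>, writing \<open>B = A D\<^sup>k\<close> with \<open>det A = 1\<close> gives the semidirect product.\<close>

section \<open>Decomposable bivectors\<close>

definition skew :: "(real^'n^'n) set"
  where "skew = {X. transpose X = - X}"

lemma skew_iff: "X \<in> skew \<longleftrightarrow> (\<forall>i j. X$i$j = - X$j$i)"
  unfolding skew_def transpose_def vec_eq_iff by simp blast

lemma skew_nth: "X \<in> skew \<Longrightarrow> X$i$j = - X$j$i"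
  unfolding skew_iff by blast

lemma subspace_skew: "subspace (skew :: (real^'n^'n) set)"
proof -
  have "transpose (X + Y) = transpose X + transpose Y" "transpose (c *\<^sub>R X) = c *\<^sub>R transpose X"
    for X Y :: "real^'n^'n" and c
    by (simp_all add: transpose_def vec_eq_iff)
  moreover have "transpose 0 = (0 :: real^'n^'n)"
    by (simp add: transpose_def vec_eq_iff)
  ultimately show ?thesis
    by (simp add: subspace_def skew_def)
qed

definition wedge :: "real^'n \<Rightarrow> real^'n \<Rightarrow> real^'n^'n"
  where "wedge x y = (\<chi> i j. x$i * y$j - x$j * y$i)"

lemma wedge_nth [simp]: "wedge x y $ i $ j = x$i * y$j - x$j * y$i"
  by (simp add: wedge_def)

lemma wedge_simps:
  "wedge (x + x') y = wedge x y + wedge x' y" "wedge x (y + y') = wedge x y + wedge x y'"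
  "wedge (x - x') y = wedge x y - wedge x' y" "wedge x (y - y') = wedge x y - wedge x y'"
  "wedge (c *\<^sub>R x) y = c *\<^sub>R wedge x y" "wedge x (c *\<^sub>R y) = c *\<^sub>R wedge x y"
  "wedge x x = 0" "wedge 0 y = 0" "wedge x 0 = 0"
  by (simp_all add: vec_eq_iff algebra_simps)

lemma wedge_commute: "wedge x y = - wedge y x"
  by (simp add: vec_eq_iff algebra_simps)

lemma wedge_skew [simp]: "wedge x y \<in> skew"
  by (simp add: skew_iff algebra_simps)

lemma linear_wedge: "linear (wedge x)"
  by (rule linearI) (simp_all add: wedge_simps)

definition decomposable :: "real^'n^'n \<Rightarrow> bool"
  where "decomposable S \<longleftrightarrow> (\<exists>x y. S = wedge x y)"

text \<open>The Pfaffian of the 4 x 4 submatrix on these indices, for skew \<open>S\<close> half a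
  coordinate of S \<and> S. Its vanishing is a Pluecker relation.\<close>

definition pluecker :: "real^'n^'n \<Rightarrow> 'n \<Rightarrow> 'n \<Rightarrow> 'n \<Rightarrow> 'n \<Rightarrow> real"
  where "pluecker S i j k l = S$i$j * S$k$l - S$i$k * S$j$l + S$i$l * S$j$k"

text \<open>The coordinates of the trivector \<open>x \<and> S\<close>.\<close>

definition triv :: "real^'n \<Rightarrow> real^'n^'n \<Rightarrow> 'n \<Rightarrow> 'n \<Rightarrow> 'n \<Rightarrow> real"
  where "triv x S i j k = x$i * S$j$k - x$j * S$i$k + x$k * S$i$j"

lemma pluecker_decomposable: "decomposable S \<Longrightarrow> pluecker S i j k l = 0"
  by (auto simp: decomposable_def pluecker_def algebra_simps)

lemma triv_wedge: "triv x (wedge x z) i j k = 0"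
  by (simp add: triv_def algebra_simps)

text \<open>Rows \<open>i\<close> and \<open>j\<close> of \<open>S\<close> span the plane: the
  relations that contain the pivot pair express every entry through these two rows.\<close>

lemma decomposable_if_pivot:
  assumes S: "S \<in> skew" and ij: "S$i$j \<noteq> 0" and pl: "\<And>k l. pluecker S i j k l = 0"
  shows "decomposable S"
proof -
  have "S = wedge ((1 / S$i$j) *\<^sub>R S$i) (S$j)"
  proof (simp add: vec_eq_iff, intro allI)
    fix k l
    have "S$i$j * S$k$l = S$i$k * S$j$l - S$i$l * S$j$k"
      using pl[of k l] by (simp add: pluecker_def)
    then show "S$k$l = S$i$k * S$j$l / S$i$j - S$i$l * S$j$k / S$i$j"
      using ij by (simp add: field_simps)
  qed
  then show ?thesis
    unfolding decomposable_def by blast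
qed

text \<open>A bivector annihilated by \<open>x\<close> is divisible by \<open>x\<close>; the
  quotient is a row of \<open>S\<close> over a nonzero coordinate of \<open>x\<close>.\<close>

lemma wedge_if_triv:
  assumes x: "x \<noteq> 0" and tr: "\<And>i j k. triv x S i j k = 0"
  obtains z where "S = wedge x z"
proof -
  obtain i where "x$i \<noteq> 0"
    using x by (auto simp: vec_eq_iff)
  have "S = wedge x ((1 / x$i) *\<^sub>R S$i)"
  proof (simp add: vec_eq_iff, intro allI)
    fix j k
    have "x$i * S$j$k = x$j * S$i$k - x$k * S$i$j"
      using tr[of i j k] by (simp add: triv_def)
    then show "S$j$k = x$j * S$i$k / x$i - x$k * S$i$j / x$i"
      using \<open>x$i \<noteq> 0\<close> by (simp add: field_simps)
  qed
  then show thesis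
    using that by blast
qed

text \<open>Cramer's rule: relative to a nonzero 2 x 2 minor of \<open>x\<close> and
  \<open>y\<close>, the coefficients of \<open>z\<close> are the minors in which \<open>z\<close>
  replaces \<open>x\<close> or \<open>y\<close>.\<close>

lemma in_plane_if_triv:
  assumes w: "wedge x y \<noteq> 0" and tr: "\<And>i j k. triv z (wedge x y) i j k = 0"
  obtains p q where "z = p *\<^sub>R x + q *\<^sub>R y"
proof -
  obtain i j where ij: "wedge x y $ i $ j \<noteq> 0"
    using w by (auto simp: vec_eq_iff)
  define d where "d = wedge x y $ i $ j"
  have d: "d *\<^sub>R z = (z$i * y$j - z$j * y$i) *\<^sub>R x + (x$i * z$j - x$j * z$i) *\<^sub>R y"
    using tr[of i j] by (simp add: vec_eq_iff triv_def d_def algebra_simps)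
  have "z = (1 / d) *\<^sub>R (d *\<^sub>R z)"
    using ij by (simp add: d_def)
  then have "z = ((z$i * y$j - z$j * y$i) / d) *\<^sub>R x + ((x$i * z$j - x$j * z$i) / d) *\<^sub>R y"
    unfolding d by (simp add: scaleR_right_distrib)
  then show thesis
    using that by blast
qed

lemma in_plane_if_wedge_eq:
  assumes "wedge x y = wedge x' z" and "wedge x y \<noteq> 0"
  obtains p q where "x' = p *\<^sub>R x + q *\<^sub>R y"
proof (rule in_plane_if_triv[OF assms(2)])
  show "triv x' (wedge x y) i j k = 0" for i j k
    unfolding assms(1) by (rule triv_wedge)
qed (rule that)

text \<open>The equations of x \<and> T = 0 that contain a pivot pair imply all others:
  \<open>T$i$j\<close> times any coordinate is a combination of those equations and of Pluecker
  coordinates of \<open>T\<close>.\<close>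

lemma triv_pivot:
  assumes T: "T \<in> skew" and ij: "T$i$j \<noteq> 0" and pl: "\<And>i j k l. pluecker T i j k l = 0"
    and tr: "\<And>k. triv x T i j k = 0"
  shows "triv x T k l m = 0"
proof -
  have "T$i$j * triv x T k l m = triv x T i j k * T$l$m - triv x T i j l * T$k$m + triv x T i j m * T$k$l
      - x$i * pluecker T j k l m + x$j * pluecker T i k l m"
    by (simp add: triv_def pluecker_def algebra_simps)
  then show ?thesis
    using ij pl tr by simp
qed

text \<open>As S \<and> S, T \<and> T and (S + T) \<and> (S + T) vanish, so does S \<and> T, and the
  planes of \<open>S\<close> and \<open>T\<close> share a vector. Projectively, two lines
  meet.\<close>

lemma common_vector:
  assumes S: "decomposable S" and T: "decomposable T" and ST: "decomposable (S + T)" and "S \<noteq> 0"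
  obtains x y z where "x \<noteq> 0" "S = wedge x y" "T = wedge x z"
proof -
  obtain a b where ab: "S = wedge a b"
    using S by (auto simp: decomposable_def)
  have Tskew: "T \<in> skew"
    using T by (auto simp: decomposable_def)
  have ne: "a \<noteq> 0" "b \<noteq> 0"
    using \<open>S \<noteq> 0\<close> ab by (auto simp: wedge_simps)
  have "\<exists>x. x \<noteq> 0 \<and> (\<forall>i j k. triv x T i j k = 0) \<and> (\<exists>p q. x = p *\<^sub>R a + q *\<^sub>R b)"
  proof (cases "T = 0")
    case True
    then show ?thesis
      using ne by (intro exI[of _ a]) (auto simp: triv_def intro: exI[of _ 1] exI[of _ 0])
  next
    case False
    then obtain i j where ij: "T$i$j \<noteq> 0"
      by (auto simp: vec_eq_iff)
    have pT: "pluecker T i j k l = 0" for i j k l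
      using T by (rule pluecker_decomposable)
    \<comment> \<open>Polarization of the Pluecker relations: these are the coordinates of S \<and>
      T.\<close>
    have cross: "S$i$j * T$k$l - S$i$k * T$j$l + S$i$l * T$j$k + T$i$j * S$k$l - T$i$k * S$j$l + T$i$l * S$j$k = 0" for i j k l
      using pluecker_decomposable[OF ST, of i j k l] pluecker_decomposable[OF S, of i j k l] pT[of i j k l]
      by (simp add: pluecker_def algebra_simps)
    \<comment> \<open>The coordinates of a \<and> T and b \<and> T at the pivot pair. They turn out
      to be linearly dependent (\<open>ab0\<close>), so a nontrivial combination of \<open>a\<close>
      and \<open>b\<close> annihilates \<open>T\<close>.\<close>
    define \<alpha> where "\<alpha> = triv a T i j"
    define \<beta> where "\<beta> = triv b T i j"
    have ab0: "\<alpha> k * \<beta> l - \<alpha> l * \<beta> k = 0" for k l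
    proof -
      have "\<alpha> k * \<beta> l - \<alpha> l * \<beta> k = T$i$j * (S$i$j * T$k$l - S$i$k * T$j$l + S$i$l * T$j$k + T$i$j * S$k$l - T$i$k * S$j$l + T$i$l * S$j$k)
         - S$i$j * pluecker T i j k l"
        by (simp add: \<alpha>_def \<beta>_def triv_def ab pluecker_def algebra_simps)
      then show ?thesis
        using cross[of i j k l] pT by simp
    qed
    obtain p q where pq: "p \<noteq> 0 \<or> q \<noteq> 0" "\<And>k. p * \<alpha> k + q * \<beta> k = 0"
    proof (cases "\<forall>k. \<alpha> k = 0")
      case True
      then show ?thesis using that[of 1 0] by simp
    next
      case False
      then obtain k where "\<alpha> k \<noteq> 0" by blast
      moreover have "\<beta> k * \<alpha> l + (- \<alpha> k) * \<beta> l = 0" for l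
        using ab0[of k l] by (simp add: algebra_simps)
      ultimately show ?thesis using that[of "\<beta> k" "- \<alpha> k"] by simp
    qed
    define x where "x = p *\<^sub>R a + q *\<^sub>R b"
    have "triv x T i j k = 0" for k
      using pq(2)[of k] by (simp add: x_def \<alpha>_def \<beta>_def triv_def algebra_simps)
    then have "triv x T k l m = 0" for k l m
      using triv_pivot[OF Tskew ij pT] by blast
    moreover have "x \<noteq> 0"
    proof
      assume "x = 0"
      moreover have "wedge x b = p *\<^sub>R S" "wedge a x = q *\<^sub>R S"
        by (simp_all add: x_def ab wedge_simps)
      ultimately show False
        using pq(1) \<open>S \<noteq> 0\<close> by (auto simp: wedge_simps)
    qed
    ultimately show ?thesis
      unfolding x_def by blast
  qed
  then obtain x p q where x: "x \<noteq> 0" "\<And>i j k. triv x T i j k = 0" "x = p *\<^sub>R a + q *\<^sub>R b"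
    by blast
  have "triv x S i j k = 0" for i j k
    by (simp add: x(3) ab triv_def algebra_simps)
  then obtain y where y: "S = wedge x y"
    using wedge_if_triv[OF x(1)] by blast
  obtain z where "T = wedge x z"
    using wedge_if_triv[OF x(1,2)] by blast
  with y show thesis
    using that x(1) by blast
qed

lemma wedge_eq_0:
  assumes "wedge x y = 0" "x \<noteq> 0"
  obtains k where "y = k *\<^sub>R x"
proof -
  obtain i where i: "x$i \<noteq> 0"
    using assms(2) by (auto simp: vec_eq_iff)
  have "y$j = (y$i / x$i) * x$j" for j
  proof -
    have "wedge x y $ i $ j = 0"
      using assms(1) by simp
    then have "x$i * y$j = x$j * y$i"
      by simp
    then show ?thesis
      using i by (simp add: field_simps)
  qed
  then have "y = (y$i / x$i) *\<^sub>R x"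
    unfolding vec_eq_iff vector_scaleR_component real_scaleR_def by blast
  then show thesis
    by (rule that)
qed

text \<open>Only one line passes through two distinct points of a projective space. Here z \<and> x
  \<and> y = - y \<and> (x \<and> z) = 0 puts the second factor \<open>z\<close> into the plane of
  \<open>x\<close> and \<open>y\<close>.\<close>

lemma star_Int_star:
  assumes "S \<in> range (wedge x)" "S \<in> range (wedge y)" "wedge x y \<noteq> 0"
  obtains r where "S = r *\<^sub>R wedge x y"
proof -
  obtain z z' where z: "S = wedge x z" "S = wedge y z'"
    using assms by blast
  have "triv z (wedge x y) i j k = - triv y S i j k" for i j k
    unfolding z(1) by (simp add: triv_def algebra_simps)
  then have "triv z (wedge x y) i j k = 0" for i j k
    unfolding z(2) triv_wedge by simp
  then obtain p q where "z = p *\<^sub>R x + q *\<^sub>R y"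
    using in_plane_if_triv[OF assms(3)] by blast
  then have "S = q *\<^sub>R wedge x y"
    by (simp add: z(1) wedge_simps)
  then show thesis
    by (rule that)
qed

text \<open>Pairwise meeting lines in a projective space are concurrent or coplanar; the coplanar ones
  correspond to elements of the exterior square of a three-dimensional space, which is too small here.\<close>

lemma decomposable_subspace_concurrent:
  assumes M: "subspace M" and dec: "\<And>S. S \<in> M \<Longrightarrow> decomposable S" and dim: "dim M \<ge> 4"
  obtains a where "a \<noteq> 0" "M \<subseteq> range (wedge a)"
proof -
  have small: False if "M \<subseteq> span B" "finite B" "card B \<le> 3" for B
    using dim_le_card[OF that(1,2)] that(3) dim by linarith
  obtain S where S: "S \<in> M" "S \<noteq> 0"
    using small[of "{}"] by auto
  obtain S' where S': "S' \<in> M" "S' \<notin> span {S}"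
    using small[of "{S}"] by auto
  have meet: thesis if "R \<in> M" "T \<in> M" "R \<noteq> 0" "\<And>x y z. x \<noteq> 0 \<Longrightarrow> R = wedge x y \<Longrightarrow> T = wedge x z \<Longrightarrow> thesis"
    for R T thesis
    using common_vector[of R T] dec that subspace_add[OF M] by blast
  \<comment> \<open>The candidate for the centre is the point common to two independent elements of
    \<open>M\<close>.\<close>
  obtain a b c where a: "a \<noteq> 0" and b: "S = wedge a b" and c: "S' = wedge a c"
    using meet[OF S(1) S'(1) S(2)] by blast
  have indep: "p = 0 \<and> q = 0" if "p *\<^sub>R S + q *\<^sub>R S' = 0" for p q
  proof -
    have "q = 0"
    proof (rule ccontr)
      assume q: "q \<noteq> 0"
      have "q *\<^sub>R S' = (- p) *\<^sub>R S"
        using that by (simp add: eq_neg_iff_add_eq_0 add.commute)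
      then have "(1 / q) *\<^sub>R (q *\<^sub>R S') = (1 / q) *\<^sub>R ((- p) *\<^sub>R S)"
        by simp
      then have "S' = (- p / q) *\<^sub>R S"
        using q by simp
      then have "S' \<in> span {S}"
        using span_scale[OF span_base[of S "{S}"], of "- p / q"] by simp
      then show False
        using S'(2) by blast
    qed
    then show ?thesis
      using that S(2) by simp
  qed
  \<comment> \<open>A line of \<open>M\<close> that misses \<open>a\<close> meets the line a \<and>
    u in a point other than \<open>a\<close>; scaled to have \<open>u\<close>-coefficient one, this
    point is \<open>u + l *\<^sub>R a\<close>.\<close>
  have shift: "\<exists>l. R \<in> range (wedge (u + l *\<^sub>R a))"
    if R: "R \<in> M" "R \<notin> range (wedge a)" and u: "wedge a u \<in> M" "wedge a u \<noteq> 0" for R u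
  proof -
    obtain p y z where p: "p \<noteq> 0" "wedge a u = wedge p y" "R = wedge p z"
      using meet[OF u(1) R(1) u(2)] by blast
    obtain p1 p2 where pe: "p = p1 *\<^sub>R a + p2 *\<^sub>R u"
      using in_plane_if_wedge_eq[OF p(2) u(2)] by blast
    have "p2 \<noteq> 0"
    proof
      assume "p2 = 0"
      then have "R = wedge a (p1 *\<^sub>R z)"
        by (simp add: p(3) pe wedge_simps)
      then show False
        using R(2) by blast
    qed
    then have "R = wedge (u + (p1 / p2) *\<^sub>R a) (p2 *\<^sub>R z)"
      by (simp add: p(3) pe wedge_simps scaleR_right_distrib add.commute)
    then show ?thesis
      by blast
  qed
  \<comment> \<open>Such a line meets both \<open>S\<close> and \<open>S'\<close> away from
    \<open>a\<close>, so it joins a point on each of them and lies in the plane of \<open>a\<close>,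
    \<open>b\<close>, \<open>c\<close>.\<close>
  have planar: "\<exists>r l m. R = r *\<^sub>R wedge (b + l *\<^sub>R a) (c + m *\<^sub>R a)"
    if R: "R \<in> M" "R \<notin> range (wedge a)" for R
  proof -
    have "S' \<noteq> 0"
      using indep[of 0 1] by auto
    then obtain l m where l: "R \<in> range (wedge (b + l *\<^sub>R a))" and m: "R \<in> range (wedge (c + m *\<^sub>R a))"
      using shift[OF R] S S' unfolding b c by metis
    have "wedge (b + l *\<^sub>R a) (c + m *\<^sub>R a) \<noteq> 0"
    proof
      assume 0: "wedge (b + l *\<^sub>R a) (c + m *\<^sub>R a) = 0"
      have "b + l *\<^sub>R a \<noteq> 0"
      proof
        assume "b + l *\<^sub>R a = 0"
        then have "wedge a (b + l *\<^sub>R a) = 0"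
          by (simp add: wedge_simps(9))
        then show False
          using S(2) by (simp add: b wedge_simps)
      qed
      then obtain k where "c + m *\<^sub>R a = k *\<^sub>R (b + l *\<^sub>R a)"
        using wedge_eq_0[OF 0] by blast
      then have "wedge a (c + m *\<^sub>R a) = wedge a (k *\<^sub>R (b + l *\<^sub>R a))"
        by simp
      then have "S' = k *\<^sub>R S"
        by (simp add: wedge_simps b c)
      then show False
        using indep[of "- k" 1] by simp
    qed
    then show ?thesis
      using star_Int_star[OF l m] by metis
  qed
  have "M \<subseteq> range (wedge a)"
  proof (rule ccontr)
    assume "\<not> M \<subseteq> range (wedge a)"
    then obtain R where R: "R \<in> M" "R \<notin> range (wedge a)"
      by blast
    have R0: "R \<noteq> 0"
      using R(2) wedge_simps(9)[of a] by (metis rangeI)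
    obtain r l m where r: "R = r *\<^sub>R wedge (b + l *\<^sub>R a) (c + m *\<^sub>R a)"
      using planar[OF R] by blast
    \<comment> \<open>Generators of the exterior square of the span of \<open>a\<close>,
      \<open>b\<close>, \<open>c\<close>. One line \<open>R\<close> that misses \<open>a\<close>
      forces all of \<open>M\<close> into it, against \<open>dim M \<ge> 4\<close>.\<close>
    let ?B = "{S, S', wedge b c}"
    have "M \<subseteq> span ?B"
    proof
      fix T assume T: "T \<in> M"
      show "T \<in> span ?B"
      proof (cases "T \<in> range (wedge a)")
        \<comment> \<open>A line through \<open>a\<close> meets \<open>R\<close> in a point
          \<open>p\<close> of that plane, so it is the line joining \<open>a\<close> and
          \<open>p\<close>.\<close>
        case True
        obtain p y z where p: "p \<noteq> 0" "R = wedge p y" "T = wedge p z"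
          using meet[OF R(1) T R0] by blast
        have "wedge (b + l *\<^sub>R a) (r *\<^sub>R (c + m *\<^sub>R a)) = wedge p y"
          using p(2) r by (simp only: wedge_simps)
        moreover have "wedge (b + l *\<^sub>R a) (r *\<^sub>R (c + m *\<^sub>R a)) \<noteq> 0"
          using R0 r by (simp only: wedge_simps not_False_eq_True)
        ultimately obtain p1 p2 where pe: "p = p1 *\<^sub>R (b + l *\<^sub>R a) + p2 *\<^sub>R (r *\<^sub>R (c + m *\<^sub>R a))"
          using in_plane_if_wedge_eq by blast
        have ap: "wedge a p = p1 *\<^sub>R S + (p2 * r) *\<^sub>R S'"
          by (simp add: pe b c wedge_simps)
        have "wedge a p \<noteq> 0"
          using indep[of p1 "p2 * r"] ap p(1) pe by auto
        then obtain t where "T = t *\<^sub>R wedge a p"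
          using star_Int_star[of T a p] True p(3) by blast
        then have "T = (t * p1) *\<^sub>R S + (t * (p2 * r)) *\<^sub>R S'"
          by (simp add: ap scaleR_right_distrib)
        then show ?thesis
          by (simp add: span_add span_scale span_base)
      next
        case False
        then obtain r l m where "T = r *\<^sub>R wedge (b + l *\<^sub>R a) (c + m *\<^sub>R a)"
          using planar[OF T] by blast
        then have "T = r *\<^sub>R (wedge b c + (- m) *\<^sub>R S + l *\<^sub>R S')"
          by (simp add: wedge_simps b c wedge_commute[of b a])
        moreover have "S \<in> span ?B" "S' \<in> span ?B" "wedge b c \<in> span ?B"
          by (simp_all add: span_base)
        ultimately show ?thesis
          by (simp only: span_add span_scale)
      qed
    qed
    then show False
      using small[of ?B] card_insert_le_m1[of 3 "{S', wedge b c}" S] by (simp add: card_insert_if)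
  qed
  with a show thesis
    by (rule that)
qed


section \<open>The Pfaffian\<close>

lemma exhaust_6:
  fixes x :: 6
  shows "x = 1 \<or> x = 2 \<or> x = 3 \<or> x = 4 \<or> x = 5 \<or> x = 6"
proof (induct x)
  case (of_int z)
  then have "z = 0 \<or> z = 1 \<or> z = 2 \<or> z = 3 \<or> z = 4 \<or> z = 5" by fastforce
  then show ?case by auto
qed

lemma forall_6: "(\<forall>i::6. P i) \<longleftrightarrow> P 1 \<and> P 2 \<and> P 3 \<and> P 4 \<and> P 5 \<and> P 6"
  by (metis exhaust_6)

lemma UNIV_6: "UNIV = {1, 2, 3, 4, 5, 6::6}"
  using exhaust_6 by auto

lemma prod_6: "prod f (UNIV :: 6 set) = f 1 * f 2 * f 3 * f 4 * f 5 * f 6"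
  by (subst UNIV_6) (simp add: mult.assoc)

text \<open>Expansion along the first row; the \<open>pluecker\<close> terms are the complementary 4
  x 4 Pfaffians.\<close>

definition Pf :: "real^6^6 \<Rightarrow> real"
  where "Pf X = X$1$2 * pluecker X 3 4 5 6 - X$1$3 * pluecker X 2 4 5 6 + X$1$4 * pluecker X 2 3 5 6
    - X$1$5 * pluecker X 2 3 4 6 + X$1$6 * pluecker X 2 3 4 5"

section \<open>Congruence transformations and their effect on the Pfaffian\<close>

definition congr :: "real^'n^'n \<Rightarrow> real^'n^'n \<Rightarrow> real^'n^'n"
  where "congr A X = A ** X ** transpose A"

lemma congr_mult: "congr (A ** B) X = congr A (congr B X)"
  by (simp add: congr_def matrix_transpose_mul matrix_mul_assoc)

lemma congr_one: "congr (mat 1) X = X"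
  by (simp add: congr_def)

lemma congr_nth: "congr A X $ i $ j = (\<Sum>k\<in>UNIV. \<Sum>l\<in>UNIV. A$i$k * X$k$l * A$j$l)"
proof -
  have "congr A X $ i $ j = (\<Sum>l\<in>UNIV. \<Sum>k\<in>UNIV. A$i$k * X$k$l * A$j$l)"
    by (simp add: congr_def matrix_matrix_mult_def transpose_def sum_distrib_right)
  also have "\<dots> = (\<Sum>k\<in>UNIV. \<Sum>l\<in>UNIV. A$i$k * X$k$l * A$j$l)"
    by (rule sum.swap)
  finally show ?thesis .
qed

lemma linear_congr: "linear (congr A)"
  by (rule linearI)
    (simp_all add: vec_eq_iff congr_nth sum.distrib sum_distrib_left algebra_simps)

lemma congr_skew:
  assumes "X \<in> skew" shows "congr A X \<in> skew"
proof -
  have t: "transpose X = - X"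
    using assms by (simp add: skew_def)
  have m: "A ** (- X) = - (A ** X)" "(- X) ** A = - (X ** A)" for A X :: "real^'n^'n"
    by (simp_all add: vec_eq_iff matrix_matrix_mult_def sum_negf)
  show ?thesis
    by (simp add: skew_def congr_def matrix_transpose_mul t m matrix_mul_assoc)
qed

lemma congr_wedge: "congr A (wedge x y) = wedge (A *v x) (A *v y)"
proof -
  have "(\<Sum>k\<in>UNIV. \<Sum>l\<in>UNIV. A$i$k * (x$k * y$l - x$l * y$k) * A$j$l)
      = (A *v x)$i * (A *v y)$j - (A *v x)$j * (A *v y)$i" for i j
  proof -
    have "(\<Sum>k\<in>UNIV. \<Sum>l\<in>UNIV. A$i$k * (x$k * y$l - x$l * y$k) * A$j$l)
        = (\<Sum>k\<in>UNIV. \<Sum>l\<in>UNIV. (A$i$k * x$k) * (A$j$l * y$l) - (A$i$k * y$k) * (A$j$l * x$l))"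
      by (intro sum.cong refl) (simp add: algebra_simps)
    also have "\<dots> = (A *v x)$i * (A *v y)$j - (A *v y)$i * (A *v x)$j"
      by (simp add: sum_subtractf sum_product matrix_vector_mult_def)
    finally show ?thesis by simp
  qed
  then show ?thesis
    by (simp add: vec_eq_iff congr_nth)
qed

text \<open>For an elementary matrix the congruence adds \<open>c\<close> times row \<open>n\<close>
  to row \<open>m\<close> and does the same to the columns; the last term sits where the two
  meet.\<close>

lemma congr_row_operation:
  assumes "m \<noteq> n"
  shows "congr (\<chi> i j. if i = m \<and> j = n then c else of_bool (i = j)) X $ i $ j =
    X$i$j + (if i = m then c * X$n$j else 0) + (if j = m then c * X$i$n else 0)
    + (if i = m \<and> j = m then c * c * X$n$n else 0)"
proof -
  let ?E = "(\<chi> i j. if i = m \<and> j = n then c else of_bool (i = j)) :: real^'a^'a"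
  have E: "(\<Sum>k\<in>UNIV. ?E$i$k * f k) = f i + (if i = m then c * f n else 0)" for i and f :: "'a \<Rightarrow> real"
  proof -
    have "?E$i$k * f k = (if i = k then f k else 0) + (if k = n then (if i = m then c * f k else 0) else 0)" for k
      using assms by auto
    then show ?thesis
      by (simp only: sum.distrib sum.delta sum.delta' finite UNIV_I if_True)
  qed
  have "congr ?E X $ i $ j = (\<Sum>k\<in>UNIV. ?E$i$k * (\<Sum>l\<in>UNIV. ?E$j$l * X$k$l))"
    unfolding congr_nth sum_distrib_left by (simp add: ac_simps)
  then show ?thesis
    unfolding E by (auto simp: algebra_simps)
qed

lemma skew_6_simps:
  fixes X :: "real^6^6"
  assumes "X \<in> skew"
  shows "X$i$i = 0" "X$2$1 = - X$1$2" "X$3$1 = - X$1$3" "X$4$1 = - X$1$4" "X$5$1 = - X$1$5"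
    "X$6$1 = - X$1$6" "X$3$2 = - X$2$3" "X$4$2 = - X$2$4" "X$5$2 = - X$2$5" "X$6$2 = - X$2$6"
    "X$4$3 = - X$3$4" "X$5$3 = - X$3$5" "X$6$3 = - X$3$6" "X$5$4 = - X$4$5" "X$6$4 = - X$4$6"
    "X$6$5 = - X$5$6"
proof -
  show "X$i$i = 0"
    using skew_nth[OF assms, of i i] by simp
qed (rule skew_nth[OF assms])+

text \<open>Both sides are compatible with products of matrices, so it suffices to treat matrices
  with a zero row, diagonal matrices, swaps and row additions, each by expansion.\<close>

lemma Pf_congr:
  assumes "X \<in> skew"
  shows "Pf (congr A X) = det A * Pf X"
proof -
  \<comment> \<open>The quantifier over \<open>X\<close> belongs to the induction: the product case
    uses the hypothesis on \<open>A\<close> at \<open>congr B X\<close>.\<close>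
  have "\<forall>X\<in>skew. Pf (congr A X) = det A * Pf X"
  proof (induction A rule: induct_matrix_elementary)
    case (1 A B)
    then show ?case
      by (simp add: congr_mult congr_skew det_mul)
  next
    case (2 A i)
    then have "A$i$k = 0" for k
      by (simp add: row_def vec_eq_iff)
    then have "congr A X $ i $ j = 0" "congr A X $ j $ i = 0" for j X
      by (simp_all add: congr_nth)
    then have "Pf (congr A X) = 0" for X
      using exhaust_6[of i] unfolding Pf_def pluecker_def by (elim disjE) simp_all
    moreover have "det A = 0"
      using 2 by (rule det_zero_row)
    ultimately show ?case
      by simp
  next
    case (3 A)
    have s: "(\<Sum>k\<in>UNIV. A$i$k * f k) = A$i$i * f i" for i and f :: "6 \<Rightarrow> real"
    proof -
      have "(\<Sum>k\<in>UNIV. A$i$k * f k) = (\<Sum>k\<in>UNIV. if k = i then A$i$i * f i else 0)"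
        by (rule sum.cong) (use 3[of i] in auto)
      then show ?thesis by simp
    qed
    have "congr A X $ i $ j = (\<Sum>k\<in>UNIV. A$i$k * (\<Sum>l\<in>UNIV. A$j$l * X$k$l))" for X i j
      unfolding congr_nth sum_distrib_left by (simp add: ac_simps)
    then have "congr A X $ i $ j = A$i$i * A$j$j * X$i$j" for X i j
      unfolding s by simp
    moreover have "det A = A$1$1 * A$2$2 * A$3$3 * A$4$4 * A$5$5 * A$6$6"
      unfolding prod_6[of "\<lambda>i. A$i$i", symmetric] by (rule det_diagonal) (erule 3)
    ultimately show ?case
      unfolding Pf_def pluecker_def by (simp add: algebra_simps)
  next
    case (4 m n)
    let ?\<tau> = "Transposition.transpose m n"
    let ?E = "(\<chi> i j. mat 1 $ i $ ?\<tau> j) :: real^6^6"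
    have E: "(\<Sum>k\<in>UNIV. ?E$i$k * f k) = f (?\<tau> i)" for i and f :: "6 \<Rightarrow> real"
    proof -
      have "(\<Sum>k\<in>UNIV. ?E$i$k * f k) = (\<Sum>k\<in>UNIV. if k = ?\<tau> i then f k else 0)"
        by (rule sum.cong) (auto simp: mat_def transpose_eq_iff)
      then show ?thesis by simp
    qed
    have "congr ?E X $ i $ j = (\<Sum>k\<in>UNIV. ?E$i$k * (\<Sum>l\<in>UNIV. ?E$j$l * X$k$l))" for X i j
      unfolding congr_nth sum_distrib_left by (simp add: ac_simps)
    then have c: "congr ?E X $ i $ j = X $ ?\<tau> i $ ?\<tau> j" for X i j
      unfolding E by simp
    have d: "det ?E = - 1"
      using det_permute_columns[of ?\<tau> "mat 1 :: real^6^6"] 4 by (simp add: permutes_swap_id sign_swap_id)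
    show ?case
    proof
      fix X :: "real^6^6" assume X: "X \<in> skew"
      show "Pf (congr ?E X) = det ?E * Pf X"
        unfolding Pf_def pluecker_def c d using \<open>m \<noteq> n\<close> exhaust_6[of m] exhaust_6[of n]
        by (elim disjE) (simp_all add: transpose_def skew_6_simps[OF X] algebra_simps)
    qed
  next
    case (5 m n c)
    let ?E = "(\<chi> i j. if i = m \<and> j = n then c else of_bool (i = j)) :: real^6^6"
    have "?E = (\<chi> k. if k = m then row m (mat 1) + c *s row n (mat 1) else row k (mat 1))"
      using 5 by (auto simp: vec_eq_iff row_def mat_def)
    then have d: "det ?E = 1"
      using det_row_operation[OF 5, of "mat 1 :: real^6^6" c] by simp
    show ?case
    proof
      fix X :: "real^6^6" assume X: "X \<in> skew"
      show "Pf (congr ?E X) = det ?E * Pf X"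
        unfolding Pf_def pluecker_def congr_row_operation[OF 5] d
        using \<open>m \<noteq> n\<close> exhaust_6[of m] exhaust_6[of n]
        by (elim disjE) (simp_all add: skew_6_simps[OF X] algebra_simps)
    qed
  qed
  with assms show ?thesis by blast
qed

text \<open>The part of \<open>Pf (S + T)\<close> that is quadratic in \<open>S\<close> pairs \<open>S \<and> S\<close> with \<open>T\<close>; the difference
  below isolates it.\<close>

lemma Pf_variation:
  "Pf (S + T) - Pf (S - T) - 2 * Pf T = 2 *
    (T$1$2 * pluecker S 3 4 5 6 - T$1$3 * pluecker S 2 4 5 6 + T$1$4 * pluecker S 2 3 5 6
    - T$1$5 * pluecker S 2 3 4 6 + T$1$6 * pluecker S 2 3 4 5 + T$2$3 * pluecker S 1 4 5 6
    - T$2$4 * pluecker S 1 3 5 6 + T$2$5 * pluecker S 1 3 4 6 - T$2$6 * pluecker S 1 3 4 5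
    + T$3$4 * pluecker S 1 2 5 6 - T$3$5 * pluecker S 1 2 4 6 + T$3$6 * pluecker S 1 2 4 5
    + T$4$5 * pluecker S 1 2 3 6 - T$4$6 * pluecker S 1 2 3 5 + T$5$6 * pluecker S 1 2 3 4)"
  unfolding Pf_def pluecker_def by (simp add: algebra_simps)

text \<open>For skew \<open>S\<close> the Pluecker coordinates are alternating in the four indices,
  so the fifteen increasing quadruples determine all of them.\<close>

lemma pluecker_zeroI:
  fixes S :: "real^6^6"
  assumes S: "S \<in> skew"
    and "pluecker S 3 4 5 6 = 0" "pluecker S 2 4 5 6 = 0" "pluecker S 2 3 5 6 = 0"
      "pluecker S 2 3 4 6 = 0" "pluecker S 2 3 4 5 = 0" "pluecker S 1 4 5 6 = 0"
      "pluecker S 1 3 5 6 = 0" "pluecker S 1 3 4 6 = 0" "pluecker S 1 3 4 5 = 0"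
      "pluecker S 1 2 5 6 = 0" "pluecker S 1 2 4 6 = 0" "pluecker S 1 2 4 5 = 0"
      "pluecker S 1 2 3 6 = 0" "pluecker S 1 2 3 5 = 0" "pluecker S 1 2 3 4 = 0"
  shows "pluecker S i j k l = 0"
proof -
  have alt: "pluecker S j i k l = - pluecker S i j k l" "pluecker S k j i l = - pluecker S k i j l"
    "pluecker S k l j i = - pluecker S k l i j" for i j k l
    unfolding pluecker_def skew_nth[OF S, of j i] by simp_all
  have rep: "pluecker S i i k l = 0" "pluecker S k i i l = 0" "pluecker S k l i i = 0" for i k l
    using alt[where j=i and i=i and k=k and l=l] by linarith+
  \<comment> \<open>Only swaps of a concrete decreasing pair are kept as rewrite rules, so that
    rewriting sorts the indices and terminates.\<close>
  note sort =
    alt[where j=2 and i=1] alt[where j=3 and i=1] alt[where j=4 and i=1]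
    alt[where j=5 and i=1] alt[where j=6 and i=1] alt[where j=3 and i=2]
    alt[where j=4 and i=2] alt[where j=5 and i=2] alt[where j=6 and i=2]
    alt[where j=4 and i=3] alt[where j=5 and i=3] alt[where j=6 and i=3]
    alt[where j=5 and i=4] alt[where j=6 and i=4] alt[where j=6 and i=5]
  have "\<forall>i j k l. pluecker S i j k l = 0"
    unfolding forall_6 by (simp add: sort rep assms(2-))
  then show ?thesis by blast
qed

lemma wedge_axis:
  "wedge (axis i 1) (axis j 1) $ k $ l = of_bool (k = i \<and> l = j) - of_bool (k = j \<and> l = i)"
  by (auto simp: axis_def)

text \<open>The right-hand side speaks of sums and \<open>Pf\<close> only, which makes
  decomposability invariant under linear preservers. By \<open>Pf_variation\<close> it says that S
  \<and> S pairs to zero with every \<open>T\<close>, and the basis bivectors as \<open>T\<close>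
  single out the Pluecker coordinates.\<close>

lemma decomposable_iff_Pf:
  assumes S: "S \<in> skew"
  shows "decomposable S \<longleftrightarrow> (\<forall>T\<in>skew. Pf (S + T) - Pf (S - T) = 2 * Pf T)"
proof
  assume d: "decomposable S"
  show "\<forall>T\<in>skew. Pf (S + T) - Pf (S - T) = 2 * Pf T"
  proof
    fix T
    have "Pf (S + T) - Pf (S - T) - 2 * Pf T = 0"
      unfolding Pf_variation by (simp add: pluecker_decomposable[OF d])
    then show "Pf (S + T) - Pf (S - T) = 2 * Pf T"
      by linarith
  qed
next
  assume h: "\<forall>T\<in>skew. Pf (S + T) - Pf (S - T) = 2 * Pf T"
  let ?V = "\<lambda>i j. wedge (axis i 1 :: real^6) (axis j 1)"
  have v: "Pf (S + ?V i j) - Pf (S - ?V i j) - 2 * Pf (?V i j) = 0" for i j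
    using bspec[OF h wedge_skew[of "axis i 1" "axis j 1"]] by linarith
  show "decomposable S"
  proof (cases "S = 0")
    case True
    then show ?thesis
      by (auto simp: decomposable_def wedge_simps intro!: exI[of _ 0])
  next
    case False
    then obtain i j where "S$i$j \<noteq> 0"
      by (auto simp: vec_eq_iff)
    moreover have "pluecker S i j k l = 0" for i j k l
      by (rule pluecker_zeroI[OF S])
        (use v[of 1 2] v[of 1 3] v[of 1 4] v[of 1 5] v[of 1 6] v[of 2 3] v[of 2 4] v[of 2 5] v[of 2 6]
          v[of 3 4] v[of 3 5] v[of 3 6] v[of 4 5] v[of 4 6] v[of 5 6] in \<open>simp_all add: Pf_variation wedge_axis del: wedge_nth\<close>)
    ultimately show ?thesis
      using decomposable_if_pivot[OF S] by blast
  qed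
qed


section \<open>Linear preservers of the Pfaffian\<close>

text \<open>The sum runs over ordered pairs, so every basis bivector is met twice; hence the
  halves.\<close>

lemma skew_expand:
  assumes S: "S \<in> skew"
  shows "S = (\<Sum>i\<in>UNIV. \<Sum>j\<in>UNIV. (S$i$j / 2) *\<^sub>R wedge (axis i 1) (axis j 1))"
proof -
  have "(\<Sum>i\<in>UNIV. \<Sum>j\<in>UNIV. (S$i$j / 2) * (wedge (axis i 1) (axis j 1) $ k $ l)) = S$k$l" for k l
  proof -
    have "(\<Sum>i\<in>UNIV. \<Sum>j\<in>UNIV. (S$i$j / 2) * (wedge (axis i 1) (axis j 1) $ k $ l))
        = (\<Sum>i\<in>UNIV. \<Sum>j\<in>UNIV. (if j = l then if i = k then S$i$j / 2 else 0 else 0))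
         - (\<Sum>i\<in>UNIV. \<Sum>j\<in>UNIV. (if j = k then if i = l then S$i$j / 2 else 0 else 0))"
      unfolding sum_subtractf[symmetric] wedge_axis by (intro sum.cong refl) auto
    also have "\<dots> = S$k$l / 2 - S$l$k / 2"
      by simp
    finally show ?thesis
      using skew_nth[OF S, of l k] by simp
  qed
  then show ?thesis
    unfolding vec_eq_iff sum_component vector_scaleR_component real_scaleR_def by (intro allI) (rule sym)
qed

lemma linear_eq_on_skew:
  assumes f: "linear f" and g: "linear g"
    and eq: "\<And>i j. i \<noteq> j \<Longrightarrow> f (wedge (axis i 1) (axis j 1)) = g (wedge (axis i 1) (axis j 1))"
    and S: "S \<in> skew"
  shows "f S = g S"
proof -
  have "f (wedge (axis i 1) (axis j 1)) = g (wedge (axis i 1) (axis j 1))" for i j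
    using eq[of i j] by (cases "i = j") (simp_all add: wedge_simps(7) linear_0[OF f] linear_0[OF g])
  then show ?thesis
    by (subst (1 2) skew_expand[OF S])
      (simp only: linear_sum[OF f] linear_sum[OF g] linear_cmul[OF f] linear_cmul[OF g])
qed

lemma ex_fresh_6: "\<exists>p q. p \<notin> {i, j} \<and> q \<notin> {i, j, p :: 6}"
proof -
  have "\<exists>p. p \<notin> A" if "card A < 6" for A :: "6 set"
  proof (rule ccontr)
    assume "\<nexists>p. p \<notin> A"
    then have "A = UNIV" by blast
    then show False using that by simp
  qed
  moreover have "card {i, j} < 6" "card {i, j, p} < 6" for p
    by (simp_all add: card_insert_if)
  ultimately show ?thesis by blast
qed

lemma Pf_uminus: "Pf (- X) = - Pf X"
  by (simp add: Pf_def pluecker_def algebra_simps)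

lemma Pf_standard:
  "Pf (wedge (axis 1 1) (axis 2 1) + wedge (axis 3 1) (axis 4 1) + wedge (axis 5 1) (axis 6 1)) = 1"
  unfolding Pf_def pluecker_def vector_add_component wedge_axis by simp

lemma mult_right_cancel_one: "a * x = 1 \<Longrightarrow> b * x = 1 \<Longrightarrow> a = b" for a b x :: real
  by (metis mult.assoc mult.commute mult.right_neutral)

text \<open>Here \<open>c\<close> collects the factors by which a preserver scales the basis bivectors, and the
  hypothesis comes from the perfect matchings in the Pfaffian.\<close>

lemma rank_one_off_diagonal:
  fixes c :: "6 \<Rightarrow> 6 \<Rightarrow> real"
  assumes sym: "\<And>i j. c i j = c j i"
    and m: "\<And>i j k l m n. distinct [i, j, k, l, m, n] \<Longrightarrow> (c i j * c k l) * (c m n * p) = 1"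
  obtains d g where "d \<noteq> 0" "\<And>i j. i \<noteq> j \<Longrightarrow> c i j = g i * g j / d"
proof -
  have ne: "c 1 2 \<noteq> 0" "c 2 3 \<noteq> 0" "c 1 3 \<noteq> 0"
    using m[of 1 2 3 4 5 6] m[of 1 3 2 4 5 6] m[of 2 3 1 4 5 6] by auto
  \<comment> \<open>Two perfect matchings that share the edge \<open>m\<close>, \<open>n\<close> are
    compared, so \<open>c i j * c k l\<close> depends only on the set of the four indices.\<close>
  have m': "c i j * c k l = c i' j' * c k' l'"
    if "distinct [i, j, k, l, m, n]" "distinct [i', j', k', l', m, n]" for i j k l i' j' k' l' m n
    using m[OF that(1)] m[OF that(2)] by (rule mult_right_cancel_one)
  have x1: "c 1 4 * c 2 3 = c 1 3 * c 2 4"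
    "c 1 5 * c 2 3 = c 1 3 * c 2 5"
    "c 1 6 * c 2 3 = c 1 3 * c 2 6"
    using m'[of 1 4 2 3 5 6 1 3 2 4]
      m'[of 1 5 2 3 4 6 1 3 2 5]
      m'[of 1 6 2 3 4 5 1 3 2 6] by simp_all
  have x2: "c 1 4 * c 2 3 = c 1 2 * c 3 4"
    "c 1 5 * c 2 3 = c 1 2 * c 3 5"
    "c 1 6 * c 2 3 = c 1 2 * c 3 6"
    using m'[of 1 4 2 3 5 6 1 2 3 4]
      m'[of 1 5 2 3 4 6 1 2 3 5]
      m'[of 1 6 2 3 4 5 1 2 3 6] by simp_all
  have x3: "c 1 4 * c 3 5 = c 1 3 * c 4 5"
    "c 1 4 * c 3 6 = c 1 3 * c 4 6"
    "c 1 5 * c 3 6 = c 1 3 * c 5 6"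
    using m'[of 1 4 3 5 2 6 1 3 4 5]
      m'[of 1 4 3 6 2 5 1 3 4 6]
      m'[of 1 5 3 6 2 4 1 3 5 6] by simp_all
  \<comment> \<open>The lower entries satisfy \<open>c j k = c 1 j * c 1 k / d\<close> for the
    \<open>d\<close> defined below; it is first shown with denominators cleared.\<close>
  have e: "c 2 3 * (c 1 2 * c 1 3) = c 1 2 * c 1 3 * c 2 3"
    by simp
  have e2: "c 2 k * (c 1 2 * c 1 3) = c 1 2 * c 1 k * c 2 3"
    "c 3 k * (c 1 2 * c 1 3) = c 1 3 * c 1 k * c 2 3" if "k \<in> {4, 5, 6}" for k
    using that x1 x2 by (auto simp: mult.left_commute mult.assoc)
  have e3: "c j k * (c 1 2 * c 1 3) = c 1 j * c 1 k * c 2 3" if "(j, k) \<in> {(4, 5), (4, 6), (5, 6)}" for j k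
  proof -
    have "c j k * (c 1 2 * c 1 3) = c 1 2 * (c 1 3 * c j k)"
      by simp
    also have "\<dots> = c 1 2 * (c 1 j * c 3 k)"
      using that x3 by auto
    also have "\<dots> = c 1 j * (c 1 2 * c 3 k)"
      by simp
    also have "\<dots> = c 1 j * (c 1 k * c 2 3)"
      using that x2 by auto
    finally show ?thesis by simp
  qed
  \<comment> \<open>With \<open>g j = c 1 j\<close> for the other indices, the entry at 2, 3 forces
    this \<open>d\<close>, and \<open>g 1 = d\<close> makes the first row come out right.\<close>
  define d where "d = c 1 2 * c 1 3 / c 2 3"
  define g where "g i = (if i = 1 then d else c 1 i)" for i
  have d: "d \<noteq> 0"
    using ne by (simp add: d_def)
  have lower: "c i j = g i * g j / d" if "c i j * (c 1 2 * c 1 3) = c 1 i * c 1 j * c 2 3" "i \<noteq> 1" "j \<noteq> 1" for i j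
    using that ne by (simp add: g_def d_def field_simps)
  have lower: "c i j = g i * g j / d \<and> c j i = g j * g i / d"
    if "c i j * (c 1 2 * c 1 3) = c 1 i * c 1 j * c 2 3" "i \<noteq> 1" "j \<noteq> 1" for i j
    using lower[OF that] sym[of i j] by (simp add: mult.commute)
  have one: "c 1 j = g 1 * g j / d \<and> c j 1 = g j * g 1 / d" if "j \<noteq> 1" for j
    using that d sym[of 1 j] by (simp add: g_def)
  have "c i j = g i * g j / d" if "i \<noteq> j" for i j
    using that exhaust_6[of i] exhaust_6[of j] one[of 2] one[of 3] one[of 4] one[of 5] one[of 6]
      lower[OF e] lower[OF e2(1)[of 4]] lower[OF e2(1)[of 5]] lower[OF e2(1)[of 6]]
      lower[OF e2(2)[of 4]] lower[OF e2(2)[of 5]] lower[OF e2(2)[of 6]]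
      lower[OF e3[of 4 5]] lower[OF e3[of 4 6]] lower[OF e3[of 5 6]]
    by (elim disjE) simp_all
  with d show thesis
    by (rule that)
qed

text \<open>The permutation matrix \<open>Q\<close> carries the standard matching 12, 34, 56 to the
  given one, so \<open>q\<close> is its determinant; it cancels when two values are
  compared.\<close>

lemma Pf_matching:
  fixes i j k l m n :: 6
  assumes dist: "distinct [i, j, k, l, m, n]"
  obtains q where "q \<noteq> 0" "\<And>x y z. Pf (x *\<^sub>R wedge (axis i 1) (axis j 1)
    + y *\<^sub>R wedge (axis k 1) (axis l 1) + z *\<^sub>R wedge (axis m 1) (axis n 1)) = q * (x * y * z)"
proof -
  define f where "f s = (if s = 1 then i else if s = 2 then j else if s = 3 then k
    else if s = 4 then l else if s = 5 then m else n)" for s :: 6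
  define Q :: "real^6^6" where "Q = (\<chi> r s. if r = f s then 1 else 0)"
  have f: "f 1 = i" "f 2 = j" "f 3 = k" "f 4 = l" "f 5 = m" "f 6 = n"
    by (simp_all add: f_def)
  have "\<forall>s t. f s = f t \<longrightarrow> s = t"
    unfolding forall_6 f using dist by auto
  then have "transpose Q ** Q = mat 1"
    by (auto simp: Q_def matrix_matrix_mult_def transpose_def mat_def vec_eq_iff if_distrib[of "\<lambda>x. x * _"]
        cong: if_cong)
  then have "det Q \<noteq> 0"
    by (metis det_I det_mul mult_zero_right zero_neq_one)
  moreover have "Pf (x *\<^sub>R wedge (axis i 1) (axis j 1) + y *\<^sub>R wedge (axis k 1) (axis l 1)
      + z *\<^sub>R wedge (axis m 1) (axis n 1)) = det Q * (x * y * z)" for x y z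
  proof -
    let ?X = "x *\<^sub>R wedge (axis 1 1) (axis 2 1) + y *\<^sub>R wedge (axis 3 1) (axis 4 1)
      + z *\<^sub>R wedge (axis 5 1) (axis 6 1) :: real^6^6"
    have Q: "Q *v axis s 1 = axis (f s) 1" for s
      unfolding matrix_vector_mult_basis column_def Q_def by (simp add: vec_eq_iff axis_def)
    have "?X \<in> skew"
      by (intro subspace_add[OF subspace_skew] subspace_scale[OF subspace_skew] wedge_skew)
    then have "Pf (congr Q ?X) = det Q * Pf ?X"
      by (rule Pf_congr)
    moreover have "Pf ?X = x * y * z"
      unfolding Pf_def pluecker_def vector_add_component vector_scaleR_component wedge_axis by simp
    ultimately show ?thesis
      by (simp add: linear_add[OF linear_congr] linear_cmul[OF linear_congr] congr_wedge Q f)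
  qed
  ultimately show thesis
    by (rule that)
qed

lemma Pf_preserver:
  fixes \<beta> :: "real^6^6 \<Rightarrow> real^6^6"
  assumes lin: "linear \<beta>" and inj: "inj_on \<beta> skew" and img: "\<beta> ` skew = skew"
    and pf: "\<And>X. X \<in> skew \<Longrightarrow> Pf (\<beta> X) = Pf X"
  obtains B where "det B = 1 \<or> det B = - 1" "\<And>X. X \<in> skew \<Longrightarrow> \<beta> X = det B *\<^sub>R congr B X"
proof -
  let ?E = "\<lambda>i j. wedge (axis i 1 :: real^6) (axis j 1)"
  have sk: "\<beta> X \<in> skew" if "X \<in> skew" for X
    using img that by blast
  \<comment> \<open>Since \<open>\<beta>\<close> maps \<open>skew\<close> onto itself, the test
    bivectors in \<open>decomposable_iff_Pf\<close> may be taken to be images.\<close>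
  have dec: "decomposable (\<beta> X) \<longleftrightarrow> decomposable X" if X: "X \<in> skew" for X
  proof -
    have eq: "Pf (\<beta> X + \<beta> T) = Pf (X + T)" "Pf (\<beta> X - \<beta> T) = Pf (X - T)" "Pf (\<beta> T) = Pf T"
      if T: "T \<in> skew" for T
      using pf[OF subspace_add[OF subspace_skew X T]] pf[OF subspace_diff[OF subspace_skew X T]] pf[OF T]
      by (simp_all add: linear_add[OF lin] linear_diff[OF lin])
    have "decomposable (\<beta> X) \<longleftrightarrow> (\<forall>T\<in>\<beta> ` skew. Pf (\<beta> X + T) - Pf (\<beta> X - T) = 2 * Pf T)"
      unfolding img by (rule decomposable_iff_Pf[OF sk[OF X]])
    also have "\<dots> \<longleftrightarrow> (\<forall>T\<in>skew. Pf (X + T) - Pf (X - T) = 2 * Pf T)"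
      unfolding ball_simps using eq by simp
    also have "\<dots> \<longleftrightarrow> decomposable X"
      by (rule decomposable_iff_Pf[OF X, symmetric])
    finally show ?thesis .
  qed
  have "\<exists>a. a \<noteq> 0 \<and> range (\<lambda>y. \<beta> (wedge (axis i 1) y)) \<subseteq> range (wedge a)" for i
  proof -
    let ?f = "\<lambda>y. \<beta> (wedge (axis i 1) y)"
    \<comment> \<open>Wedging with a basis vector kills exactly its multiples, so it is injective on
      the orthogonal hyperplane. The image of the star therefore has dimension at least five, enough
      for \<open>decomposable_subspace_concurrent\<close>.\<close>
    let ?H = "{y :: real^6. axis i 1 \<bullet> y = 0}"
    have linf: "linear ?f"
      using linear_compose[OF linear_wedge lin] by (simp add: o_def)
    have H: "subspace ?H"
      by (rule subspace_hyperplane)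
    have "inj_on ?f ?H"
    proof (rule linear_inj_on_iff_eq_0[OF linf H, THEN iffD2], intro ballI impI)
      fix y assume y: "y \<in> ?H" "?f y = 0"
      then have "wedge (axis i 1) y = 0"
        using inj_onD[OF inj, of "wedge (axis i 1) y" 0] subspace_0[OF subspace_skew] linear_0[OF lin] by simp
      then obtain k where "y = k *\<^sub>R axis i 1"
        by (rule wedge_eq_0) simp
      then show "y = 0"
        using y(1) by (simp add: inner_axis_axis)
    qed
    then have "dim (?f ` ?H) = dim ?H"
      using dim_image_eq[OF linf, of ?H] span_eq_iff[THEN iffD2, OF H] by simp
    moreover have "dim ?H = 5"
      using dim_special_hyperplane[of "axis i 1 :: real^6"] by simp
    moreover have "dim (?f ` ?H) \<le> dim (range ?f)"
      by (intro dim_subset) blast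
    ultimately have "dim (range ?f) \<ge> 4"
      by linarith
    moreover have "decomposable (wedge (axis i 1) y)" for y :: "real^6"
      unfolding decomposable_def by blast
    then have "decomposable S" if "S \<in> range ?f" for S
      using that dec[OF wedge_skew] by blast
    moreover have "subspace (range ?f)"
      by (rule linear_subspace_image[OF linf subspace_UNIV])
    ultimately obtain a where "a \<noteq> 0" "range ?f \<subseteq> range (wedge a)"
      using decomposable_subspace_concurrent by blast
    then show ?thesis by blast
  qed
  then obtain F where F0: "\<And>i. F i \<noteq> 0"
    and F: "\<And>i y. \<beta> (wedge (axis i 1) y) \<in> range (wedge (F i))"
    by (metis (no_types, lifting) rangeI subsetD)
  \<comment> \<open>If \<open>F i\<close> and \<open>F j\<close> were parallel, the images of
    \<open>?E i p\<close> and \<open>?E j q\<close> would share a factor and have a decomposable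
    sum. For four distinct indices the sum of the originals is not decomposable.\<close>
  have indep: "wedge (F i) (F j) \<noteq> 0" if ij: "i \<noteq> j" for i j
  proof
    assume "wedge (F i) (F j) = 0"
    then obtain k where k: "F j = k *\<^sub>R F i"
      using wedge_eq_0 F0 by blast
    obtain p q where pq: "p \<notin> {i, j}" "q \<notin> {i, j, p}"
      using ex_fresh_6 by blast
    obtain y z where y: "\<beta> (?E i p) = wedge (F i) y" and z: "\<beta> (?E j q) = wedge (F j) z"
      using F by blast
    have "\<beta> (?E i p + ?E j q) = wedge (F i) (y + k *\<^sub>R z)"
      by (simp add: linear_add[OF lin] y z k wedge_simps)
    then have "decomposable (?E i p + ?E j q)"
      using dec[OF subspace_add[OF subspace_skew wedge_skew wedge_skew]] unfolding decomposable_def by blast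
    then have "pluecker (?E i p + ?E j q) i p j q = 0"
      by (rule pluecker_decomposable)
    moreover have ne: "p \<noteq> i" "p \<noteq> j" "q \<noteq> i" "q \<noteq> j" "q \<noteq> p"
      using pq by auto
    have "pluecker (?E i p + ?E j q) i p j q = 1"
      unfolding pluecker_def vector_add_component wedge_axis
      by (simp add: ij ne ij[symmetric] ne[symmetric])
    ultimately show False
      by simp
  qed
  \<comment> \<open>The image lies in the stars of both \<open>F i\<close> and \<open>F j\<close>,
    which meet in the multiples of their wedge.\<close>
  have "\<exists>c. \<beta> (?E i j) = c *\<^sub>R wedge (F i) (F j)" if "i \<noteq> j" for i j
  proof -
    have "\<beta> (?E j i) \<in> range (wedge (F j))"
      by (rule F)
    then obtain z where "\<beta> (?E j i) = wedge (F j) z"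
      by blast
    then have "\<beta> (?E i j) = wedge (F j) (- z)"
      using wedge_commute[of "axis i 1" "axis j 1"] by (simp add: linear_neg[OF lin] wedge_simps(6)[of _ "-1", simplified])
    then show ?thesis
      using star_Int_star[OF F _ indep[OF that], of "axis j 1"] by blast
  qed
  then obtain c0 where c0: "\<And>i j. i \<noteq> j \<Longrightarrow> \<beta> (?E i j) = c0 i j *\<^sub>R wedge (F i) (F j)"
    by metis
  define c where "c i j = (if i = j then 0 else c0 i j)" for i j
  have c: "\<beta> (?E i j) = c i j *\<^sub>R wedge (F i) (F j)" if "i \<noteq> j" for i j
    using c0 that by (simp add: c_def)
  have csym: "c i j = c j i" for i j
  proof (cases "i = j")
    case False
    have "c i j *\<^sub>R wedge (F i) (F j) = \<beta> (- ?E j i)"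
      using c[OF False] wedge_commute[of "axis i 1" "axis j 1"] by simp
    also have "\<dots> = - (c j i *\<^sub>R wedge (F j) (F i))"
      using c[of j i] False by (simp add: linear_neg[OF lin])
    also have "\<dots> = c j i *\<^sub>R wedge (F i) (F j)"
      using wedge_commute[of "F i" "F j"] by simp
    finally show ?thesis
      using indep[OF False] by simp
  qed simp
  define P :: "real^6^6" where "P = (\<chi> k i. F i $ k)"
  have P: "P *v axis i 1 = F i" for i
    by (simp add: P_def matrix_vector_mult_basis column_def vec_eq_iff)
  \<comment> \<open>\<open>\<beta>\<close> factors on \<open>skew\<close> into this entrywise
    scaling followed by the congruence with \<open>P\<close>, whose columns are the
    \<open>F i\<close>.\<close>
  define H where "H S = (\<chi> i j. c i j * S$i$j)" for S :: "real^6^6"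
  have linH: "linear H"
    by (rule linearI) (simp_all add: H_def vec_eq_iff algebra_simps)
  have HE: "H (?E i j) = c i j *\<^sub>R ?E i j" for i j
    unfolding vec_eq_iff H_def vec_lambda_beta vector_scaleR_component wedge_axis real_scaleR_def
    using csym by auto
  have H_skew: "H S \<in> skew" if "S \<in> skew" for S
    unfolding skew_iff H_def vec_lambda_beta using csym skew_nth[OF that] by (metis mult_minus_right)
  have beta: "\<beta> S = congr P (H S)" if "S \<in> skew" for S
  proof (rule linear_eq_on_skew[OF lin _ _ that])
    show "linear (\<lambda>S. congr P (H S))"
      using linear_compose[OF linH linear_congr] by (simp add: o_def)
    show "\<beta> (?E i j) = congr P (H (?E i j))" if "i \<noteq> j" for i j
      by (simp add: c[OF that] HE linear_cmul[OF linear_congr] congr_wedge P)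
  qed
  have m: "Pf (H S) * det P = Pf S" if "S \<in> skew" for S
    using pf[OF that] Pf_congr[OF H_skew[OF that], of P] beta[OF that] by (simp add: mult.commute)
  have match: "(c i j * c k l) * (c m n * det P) = 1" if dist: "distinct [i, j, k, l, m, n]" for i j k l m n
  proof -
    obtain q where q: "q \<noteq> 0"
      "\<And>x y z. Pf (x *\<^sub>R ?E i j + y *\<^sub>R ?E k l + z *\<^sub>R ?E m n) = q * (x * y * z)"
      using Pf_matching[OF dist] by blast
    have "?E i j + ?E k l + ?E m n \<in> skew"
      by (intro subspace_add[OF subspace_skew] wedge_skew)
    from m[OF this] have "q * (c i j * c k l * c m n) * det P = q"
      using q(2)[of 1 1 1] q(2)[of "c i j" "c k l" "c m n"] by (simp add: linear_add[OF linH] HE)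
    then have "q * (c i j * c k l * (c m n * det P)) = q * 1"
      by (simp add: mult.assoc)
    then show ?thesis
      using mult_left_cancel[OF q(1)] by blast
  qed
  obtain d g where d: "d \<noteq> 0" and g: "\<And>i j. i \<noteq> j \<Longrightarrow> c i j = g i * g j / d"
    by (rule rank_one_off_diagonal[OF csym match]) (assumption, rule that)
  define G :: "real^6^6" where "G = (\<chi> i j. if i = j then g i else 0)"
  have HG: "H S = (1 / d) *\<^sub>R congr G S" if "S \<in> skew" for S
  proof (rule linear_eq_on_skew[OF linH _ _ that])
    show "linear (\<lambda>S. (1 / d) *\<^sub>R congr G S)"
      by (intro linear_compose_scale_right linear_congr)
    have "G *v axis i 1 = g i *\<^sub>R axis i 1" for i
      unfolding matrix_vector_mult_basis column_def G_def by (simp add: vec_eq_iff axis_def)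
    then show "H (?E i j) = (1 / d) *\<^sub>R congr G (?E i j)" if "i \<noteq> j" for i j
      by (simp add: HE g[OF that] congr_wedge wedge_simps)
  qed
  \<comment> \<open>So far \<open>\<beta>\<close> is the congruence with \<open>P ** G\<close>
    divided by \<open>d\<close>. The scalar \<open>s\<close> absorbs the absolute value of
    \<open>d\<close>, and the remaining sign is found to be \<open>det B\<close> by evaluating
    \<open>Pf\<close> on a bivector with Pfaffian one.\<close>
  define s where "s = 1 / sqrt \<bar>d\<bar>"
  define B where "B = s *\<^sub>R (P ** G)"
  have ss: "s * s = 1 / \<bar>d\<bar>"
    using d by (simp add: s_def)
  have "congr B S = (s * s) *\<^sub>R congr (P ** G) S" for S
    by (simp add: B_def vec_eq_iff congr_nth sum_distrib_left algebra_simps)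
  then have bB: "\<beta> S = sgn d *\<^sub>R congr B S" if "S \<in> skew" for S
    using that d by (simp add: beta HG linear_cmul[OF linear_congr] congr_mult ss sgn_if)
  have "sgn d * det B = 1"
  proof -
    let ?S = "?E 1 2 + ?E 3 4 + ?E 5 6"
    have S: "?S \<in> skew"
      by (intro subspace_add[OF subspace_skew] wedge_skew)
    have "sgn d * Pf (congr B ?S) = Pf (\<beta> ?S)"
      using d unfolding bB[OF S] by (cases "d > 0") (simp_all add: Pf_uminus)
    then show ?thesis
      using Pf_congr[OF S] pf[OF S] Pf_standard by simp
  qed
  then have "det B = sgn d"
    using d by (cases "d > 0") auto
  then have "det B = 1 \<or> det B = - 1" "\<And>X. X \<in> skew \<Longrightarrow> \<beta> X = det B *\<^sub>R congr B X"
    using d bB by (auto simp: sgn_if)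
  then show thesis
    by (rule that)
qed


section \<open>Hermitian split-quaternionic matrices as bivectors\<close>

text \<open>An index of a 6 x 6 matrix is read as a pair: a block number and a position inside the 2
  x 2 block.\<close>

definition block :: "6 \<Rightarrow> 3"
  where "block i = (if i = 1 \<or> i = 2 then 1 else if i = 3 \<or> i = 4 then 2 else 3)"

definition upper :: "6 \<Rightarrow> bool"
  where "upper i \<longleftrightarrow> i = 1 \<or> i = 3 \<or> i = 5"

definition up :: "3 \<Rightarrow> 6" where "up p = (if p = 1 then 1 else if p = 2 then 3 else 5)"
definition low :: "3 \<Rightarrow> 6" where "low p = (if p = 1 then 2 else if p = 2 then 4 else 6)"

text \<open>The entries of \<open>\<phi>(q) J\<close>, where \<open>J = (0, 1; -1, 0)\<close> and \<open>\<phi>\<close> is the isomorphism from the split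
  quaternions to the real \<open>2 \<times> 2\<close> matrices with \<open>\<phi>(i') = diag(1, -1)\<close> and \<open>\<phi>(j) = J\<close>. As conjugation
  of quaternions becomes \<open>m \<mapsto> J m\<^sup>T J\<^sup>-\<^sup>1\<close>, Hermitian matrices become skew-symmetric ones.\<close>

definition sq_entry :: "split_quat \<Rightarrow> bool \<Rightarrow> bool \<Rightarrow> real"
  where "sq_entry q s t =
    (if s then if t then - sre (sq2 q) - sim (sq2 q) else sre (sq1 q) + sim (sq1 q)
     else if t then sim (sq1 q) - sre (sq1 q) else sim (sq2 q) - sre (sq2 q))"

definition to_skew :: "split_quat^3^3 \<Rightarrow> real^6^6"
  where "to_skew X = (\<chi> i j. sq_entry (X $ block i $ block j) (upper i) (upper j))"

definition of_skew :: "real^6^6 \<Rightarrow> split_quat^3^3"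
  where "of_skew Y = (\<chi> p q.
    SQ (SC ((Y $ up p $ low q - Y $ low p $ up q) / 2) ((Y $ up p $ low q + Y $ low p $ up q) / 2))
       (SC ((- Y $ up p $ up q - Y $ low p $ low q) / 2) ((Y $ low p $ low q - Y $ up p $ up q) / 2)))"

lemma block_simps:
  "block 1 = 1" "block 2 = 1" "block 3 = 2" "block 4 = 2" "block 5 = 3" "block 6 = 3"
  "upper 1" "\<not> upper 2" "upper 3" "\<not> upper 4" "upper 5" "\<not> upper 6"
  "up 1 = 1" "up 2 = 3" "up 3 = 5" "low 1 = 2" "low 2 = 4" "low 3 = 6"
  by (simp_all add: block_def upper_def up_def low_def)

lemma block_up_low: "block (up p) = p" "block (low p) = p" "upper (up p)" "\<not> upper (low p)"
  using exhaust_3[of p] by (auto simp: block_simps)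

lemma up_block: "upper i \<Longrightarrow> up (block i) = i" "\<not> upper i \<Longrightarrow> low (block i) = i"
  using exhaust_6[of i] by (auto simp: block_simps)

lemma to_skew_of_skew: "to_skew (of_skew Y) = Y"
  by (simp add: vec_eq_iff to_skew_def of_skew_def sq_entry_def up_block field_simps)

lemma of_skew_to_skew: "of_skew (to_skew X) = X"
  by (simp add: vec_eq_iff to_skew_def of_skew_def sq_entry_def block_up_low split_quat_eq_iff
      split_complex_eq_iff)

lemma linear_to_skew: "linear to_skew"
  by (rule linearI) (simp_all add: vec_eq_iff to_skew_def sq_entry_def algebra_simps)

lemma linear_of_skew: "linear of_skew"
  by (rule linearI)
    (simp_all add: vec_eq_iff of_skew_def split_quat_eq_iff split_complex_eq_iff field_simps)

lemma sq_entry_cnj: "sq_entry (sq_cnj q) s t = - sq_entry q t s"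
  by (simp add: sq_entry_def)

lemma J3_nth: "X \<in> J3 \<longleftrightarrow> (\<forall>p q. sq_cnj (X$q$p) = X$p$q)"
  by (simp add: J3_def adjoint_sq_def transpose_def vec_eq_iff)

lemma to_skew_skew: "X \<in> J3 \<Longrightarrow> to_skew X \<in> skew"
  unfolding skew_iff J3_nth to_skew_def vec_lambda_beta by (metis sq_entry_cnj)

lemma of_skew_J3:
  assumes Y: "Y \<in> skew" shows "of_skew Y \<in> J3"
  unfolding J3_nth
proof (intro allI)
  fix p q
  show "sq_cnj (of_skew Y $ q $ p) = of_skew Y $ p $ q"
    unfolding of_skew_def vec_lambda_beta skew_nth[OF Y, of "_ q" "_ p"]
    by (simp add: split_quat_eq_iff split_complex_eq_iff field_simps)
qed

text \<open>The determinant is real on \<open>J3\<close>, so comparing real parts suffices, and this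
  is a polynomial identity in the coordinates.\<close>

lemma det_J3_eq_Pf:
  assumes "X \<in> J3" shows "det_J3 X = of_real (Pf (to_skew X))"
proof -
  obtain \<xi>1 \<xi>2 \<xi>3 :: real and x1 x2 x3 where X: "X = vector [vector [of_real \<xi>1, x3, sq_cnj x2],
                 vector [sq_cnj x3, of_real \<xi>2, x1],
                 vector [x2, sq_cnj x1, of_real \<xi>3]]"
    using assms unfolding J3_iff by blast
  have "Pf (to_skew X) = sre (sq1 (det_J3 X))"
    unfolding Pf_def pluecker_def to_skew_def vec_lambda_beta block_simps X vector_3 det_J3_def Let_def
    by (simp add: sq_entry_def block_simps of_real_def algebra_simps)
  moreover have "det_J3 X = of_real (sre (sq1 (det_J3 X)))"
    using det_J3_real[OF assms]
    by (simp add: split_quat_Reals_iff split_quat_eq_iff split_complex_eq_iff of_real_def)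
  ultimately show ?thesis by simp
qed

section \<open>The action on \<open>J3\<close> of matrices with determinant 1 or -1\<close>

definition rho :: "real^6^6 \<Rightarrow> split_quat^3^3 \<Rightarrow> split_quat^3^3"
  where "rho B = (\<lambda>X\<in>J3. of_skew (det B *\<^sub>R congr B (to_skew X)))"

lemma rho_J3: "X \<in> J3 \<Longrightarrow> rho B X \<in> J3"
  by (simp add: rho_def of_skew_J3 subspace_scale[OF subspace_skew] congr_skew to_skew_skew)

lemma to_skew_rho: "X \<in> J3 \<Longrightarrow> to_skew (rho B X) = det B *\<^sub>R congr B (to_skew X)"
  by (simp add: rho_def to_skew_of_skew)

lemma rho_eqI:
  assumes "f \<in> extensional J3" "\<And>X. X \<in> J3 \<Longrightarrow> to_skew (f X) = det B *\<^sub>R congr B (to_skew X)"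
  shows "f = rho B"
proof
  fix X
  show "f X = rho B X"
  proof (cases "X \<in> J3")
    case True
    then have "to_skew (f X) = to_skew (rho B X)"
      by (simp add: assms(2) to_skew_rho)
    then show ?thesis
      by (metis of_skew_to_skew)
  next
    case False
    then show ?thesis
      using assms(1) by (simp add: extensional_def rho_def)
  qed
qed

lemma rho_mult: "rho (B ** C) = compose J3 (rho B) (rho C)"
  by (rule rho_eqI[symmetric])
    (simp_all add: compose_eq to_skew_rho rho_J3 det_mul congr_mult linear_cmul[OF linear_congr])

lemma rho_one: "rho (mat 1) = (\<lambda>X\<in>J3. X)"
  by (rule rho_eqI[symmetric]) (simp_all add: congr_one)

lemma det_minus_6: "det (- B) = det (B :: real^6^6)"
proof -
  have "- B = (- mat 1) ** B"
    by (simp add: vec_eq_iff matrix_matrix_mult_def mat_def if_distrib[of "\<lambda>x. x * _"]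
        if_distrib[of "\<lambda>x. - x"] cong: if_cong)
  moreover have "det (- mat 1 :: real^6^6) = 1"
    by (subst det_diagonal) (simp_all add: mat_def)
  ultimately show ?thesis
    by (simp add: det_mul)
qed

text \<open>The congruence is quadratic in the matrix, and the determinant is even in dimension six.
  This lets \<open>rho\<close> descend to cosets of \<open>pm_one\<close>.\<close>

lemma rho_minus: "rho (- B) = rho B"
  by (rule rho_eqI) (simp_all add: rho_def to_skew_of_skew det_minus_6 congr_nth vec_eq_iff)

lemma E6_split_iff:
  "\<alpha> \<in> carrier E6_split \<longleftrightarrow> \<alpha> \<in> Bij J3 \<and> (\<forall>X\<in>J3. \<forall>Y\<in>J3. \<alpha> (X + Y) = \<alpha> X + \<alpha> Y)
    \<and> (\<forall>r. \<forall>X\<in>J3. \<alpha> (r *\<^sub>R X) = r *\<^sub>R \<alpha> X) \<and> (\<forall>X\<in>J3. det_J3 (\<alpha> X) = det_J3 X)"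
  by (auto simp: E6_split_def Iso_real_def)

lemma mult_E6_split:
  "\<alpha> \<in> carrier E6_split \<Longrightarrow> \<beta> \<in> carrier E6_split \<Longrightarrow> \<alpha> \<otimes>\<^bsub>E6_split\<^esub> \<beta> = compose J3 \<alpha> \<beta>"
  by (simp add: E6_split_iff) (simp add: E6_split_def Iso_real_def BijGroup_def)

lemma one_E6_split: "\<one>\<^bsub>E6_split\<^esub> = (\<lambda>X\<in>J3. X)"
  by (simp add: E6_split_def Iso_real_def BijGroup_def)

text \<open>The congruence multiplies \<open>Pf\<close> by \<open>det B\<close>, and the scalar in
  front, \<open>Pf\<close> being cubic, by the cube of \<open>det B\<close>; the product is 1 when
  \<open>det B\<close> is 1 or -1. An inverse matrix gives the inverse map.\<close>

lemma rho_in_E6_split: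
  assumes B: "det B = 1 \<or> det B = - 1"
  shows "rho B \<in> carrier E6_split"
proof -
  have "invertible B"
    using B by (auto simp: invertible_det_nz)
  then obtain C where C: "B ** C = mat 1" "C ** B = mat 1"
    by (auto simp: invertible_def)
  have inv: "rho B (rho C X) = X" "rho C (rho B X) = X" if "X \<in> J3" for X
    using that C rho_mult[of B C] rho_mult[of C B] by (metis compose_eq rho_one restrict_apply')+
  have "bij_betw (rho B) J3 J3"
    by (rule bij_betwI[where g = "rho C"]) (auto simp: rho_J3 inv)
  moreover have "rho B \<in> extensional J3"
    by (simp add: rho_def)
  moreover have "det_J3 (rho B X) = det_J3 X" if X: "X \<in> J3" for X
  proof -
    have "Pf (to_skew (rho B X)) = det B * (det B * Pf (to_skew X))"
      using B Pf_congr[OF to_skew_skew[OF X], of B] by (auto simp: to_skew_rho[OF X] Pf_uminus)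
    then show ?thesis
      using B X by (auto simp: det_J3_eq_Pf rho_J3)
  qed
  ultimately show ?thesis
    unfolding E6_split_iff Bij_def using subspace_J3
    by (simp add: rho_def linear_add[OF linear_to_skew] linear_add[OF linear_of_skew] linear_add[OF linear_congr]
        linear_cmul[OF linear_to_skew] linear_cmul[OF linear_of_skew] linear_cmul[OF linear_congr]
        scaleR_right_distrib subspace_add subspace_scale)
qed

lemma rho_surj:
  assumes \<alpha>: "\<alpha> \<in> carrier E6_split"
  obtains B where "det B = 1 \<or> det B = - 1" "\<alpha> = rho B"
proof -
  have ext: "\<alpha> \<in> extensional J3" and bij: "bij_betw \<alpha> J3 J3"
    and add: "\<And>X Y. X \<in> J3 \<Longrightarrow> Y \<in> J3 \<Longrightarrow> \<alpha> (X + Y) = \<alpha> X + \<alpha> Y"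
    and scale: "\<And>r X. X \<in> J3 \<Longrightarrow> \<alpha> (r *\<^sub>R X) = r *\<^sub>R \<alpha> X"
    and det: "\<And>X. X \<in> J3 \<Longrightarrow> det_J3 (\<alpha> X) = det_J3 X"
    using \<alpha> by (auto simp: E6_split_iff Bij_def)
  have mem: "\<alpha> X \<in> J3" if "X \<in> J3" for X
    using bij that by (auto simp: bij_betw_def)
  \<comment> \<open>The projection onto the skew part extends the transported map from
    \<open>skew\<close> to all matrices, so that it is \<open>linear\<close> on the whole
    space.\<close>
  define sp where "sp S = (1 / 2) *\<^sub>R (S - transpose S)" for S :: "real^6^6"
  have lsp: "linear sp"
    by (rule linearI) (simp_all add: sp_def transpose_def vec_eq_iff field_simps)
  have sp: "sp S \<in> skew" for S
    by (simp add: sp_def skew_def transpose_def vec_eq_iff field_simps)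
  have sp_id: "sp S = S" if "S \<in> skew" for S
    using that by (simp add: sp_def skew_def)
  define \<beta> where "\<beta> S = to_skew (\<alpha> (of_skew (sp S)))" for S
  have beta: "\<beta> S = to_skew (\<alpha> (of_skew S))" if "S \<in> skew" for S
    by (simp add: \<beta>_def sp_id[OF that])
  have "linear \<beta>"
    by (rule linearI) (simp_all add: \<beta>_def linear_add[OF lsp] linear_cmul[OF lsp] linear_add[OF linear_of_skew]
        linear_cmul[OF linear_of_skew] add scale of_skew_J3 sp linear_add[OF linear_to_skew] linear_cmul[OF linear_to_skew])
  moreover have "bij_betw \<beta> skew skew"
  proof -
    have "bij_betw of_skew skew J3" "bij_betw to_skew J3 skew"
      by (auto intro!: bij_betwI[where g = to_skew] bij_betwI[where g = of_skew]
          simp: to_skew_of_skew of_skew_to_skew of_skew_J3 to_skew_skew)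
    then have "bij_betw (to_skew \<circ> (\<alpha> \<circ> of_skew)) skew skew"
      using bij by (intro bij_betw_trans)
    moreover have "bij_betw \<beta> skew skew = bij_betw (to_skew \<circ> (\<alpha> \<circ> of_skew)) skew skew"
      by (rule bij_betw_cong) (simp add: beta)
    ultimately show ?thesis by blast
  qed
  then have "inj_on \<beta> skew" "\<beta> ` skew = skew"
    by (simp_all add: bij_betw_def)
  moreover have "Pf (\<beta> S) = Pf S" if S: "S \<in> skew" for S
  proof -
    have "of_real (Pf (\<beta> S)) = (of_real (Pf S) :: split_quat)"
      using det[OF of_skew_J3[OF S]] by (simp add: beta[OF S] det_J3_eq_Pf mem of_skew_J3 S to_skew_of_skew)
    then show ?thesis by simp
  qed
  ultimately obtain B where B: "det B = 1 \<or> det B = - 1"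
    and eq: "\<And>S. S \<in> skew \<Longrightarrow> \<beta> S = det B *\<^sub>R congr B S"
    by (rule Pf_preserver) (assumption, rule that)
  have "\<alpha> = rho B"
    by (rule rho_eqI[OF ext]) (simp add: eq[symmetric] to_skew_skew beta of_skew_to_skew)
  with B show thesis
    by (rule that)
qed

text \<open>Fixing every basis bivector puts column \<open>i\<close> of \<open>B\<close> into each
  plane of \<open>axis i 1\<close> and \<open>axis j 1\<close>, so \<open>B\<close> is diagonal.
  Comparing coefficients with a third index makes the diagonal constant, and as a real square cannot
  be -1, \<open>det B = 1\<close>.\<close>

lemma rho_eq_one:
  assumes B: "det B = 1 \<or> det B = - 1" and one: "rho B = (\<lambda>X\<in>J3. X)"
  shows "det B = 1 \<and> (B = mat 1 \<or> B = - mat 1)"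
proof -
  have fixed: "det B *\<^sub>R congr B S = S" if S: "S \<in> skew" for S
  proof -
    have "to_skew (rho B (of_skew S)) = to_skew (of_skew S)"
      using of_skew_J3[OF S] by (simp add: one)
    then show ?thesis
      by (simp add: to_skew_rho of_skew_J3[OF S] to_skew_of_skew)
  qed
  let ?b = "\<lambda>i. B *v axis i 1"
  have E: "wedge (axis i 1) (axis j 1) = det B *\<^sub>R wedge (?b i) (?b j)" for i j
    using fixed[OF wedge_skew, of "axis i 1" "axis j 1"] by (simp add: congr_wedge)
  have off: "?b i $ p = 0" if "p \<noteq> i" for i p
  proof -
    obtain j where j: "j \<notin> {i, p}"
      using ex_fresh_6 by blast
    have "wedge (axis i 1) (axis j 1) = wedge (?b i) (det B *\<^sub>R ?b j)"
      by (simp add: E[of i j] wedge_simps)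
    then have "triv (?b i) (wedge (axis i 1) (axis j 1)) p i j = 0"
      by (simp only: triv_wedge)
    moreover have ne: "j \<noteq> i" "j \<noteq> p"
      using j by auto
    ultimately show ?thesis
      unfolding triv_def wedge_axis by (simp add: that ne ne[symmetric])
  qed
  define b where "b i = ?b i $ i" for i
  have bb: "det B * (b i * b j) = 1" if "i \<noteq> j" for i j
  proof -
    have "wedge (axis i 1) (axis j 1) $ i $ j = det B * (?b i $ i * ?b j $ j - ?b i $ j * ?b j $ i)"
      by (subst E) simp
    then show ?thesis
      using that off[of i j] unfolding wedge_axis b_def by simp
  qed
  have ball: "b i = b 1" for i
  proof (cases "i = 1")
    case False
    obtain k where "k \<notin> {i, 1}"
      using ex_fresh_6 by blast
    then have "b i * (det B * b k) = 1" "b 1 * (det B * b k) = 1"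
      using bb[of i k] bb[of 1 k] by (auto simp: algebra_simps)
    then show ?thesis
      by (rule mult_right_cancel_one)
  qed simp
  have "det B * (b 1 * b 1) = 1"
    using bb[of 1 2] ball[of 2] by simp
  moreover have "b 1 * b 1 \<noteq> - 1"
    using zero_le_square[of "b 1"] by linarith
  ultimately have d: "det B = 1" and "b 1 * b 1 = 1"
    using B by auto
  then have "b 1 = 1 \<or> b 1 = - 1"
    by (simp add: square_eq_1_iff)
  moreover have "B = b 1 *\<^sub>R mat 1"
  proof -
    have "B $ p $ i = ?b i $ p" for p i
      by (simp add: matrix_vector_mult_basis column_def)
    then have "B $ p $ i = (if p = i then b 1 else 0)" for p i
      using off ball by (auto simp: b_def)
    then show ?thesis
      by (simp add: vec_eq_iff mat_def)
  qed
  ultimately show ?thesis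
    using d by auto
qed

section \<open>The semidirect product and its isomorphism onto \<open>E6_split\<close>\<close>

definition reflection :: "real^6^6"
  where "reflection = (\<chi> j k. if j = k then (if j = 1 then - 1 else 1) else 0)"

lemma reflection_mult_nth:
  "(reflection ** B) $ j $ k = (if j = 1 then - 1 else 1) * B $ j $ k"
  "(B ** reflection) $ j $ k = B $ j $ k * (if k = 1 then - 1 else 1)"
  by (simp_all add: reflection_def matrix_matrix_mult_def if_distrib[of "\<lambda>x. x * _"]
      if_distrib[of "\<lambda>x. _ * x"] cong: if_cong)

lemma reflection_reflection: "reflection ** reflection = mat 1"
  unfolding vec_eq_iff reflection_mult_nth(1) by (simp add: reflection_def mat_def)

text \<open>\<open>I_i\<close> is the imaginary unit times \<open>reflection\<close>, so both
  conjugate alike. Thus \<open>nu\<close> becomes inner in the group of matrices of determinant 1 or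
  -1.\<close>

lemma reflection_mult: "reflection ** A = nu A ** reflection"
  by (simp add: vec_eq_iff reflection_mult_nth nu_nth)

lemma det_reflection: "det reflection = - 1"
  by (subst det_diagonal) (simp_all add: reflection_def prod_6)

definition twist :: "int \<Rightarrow> real^6^6"
  where "twist k = (if k = 0 then mat 1 else reflection)"

lemma SL_Mod_pm_one_iff:
  "C \<in> carrier (SL Mod pm_one) \<longleftrightarrow> (\<exists>A. det A = 1 \<and> C = {A, - A})"
proof -
  have "(- mat 1) ** A = - A" for A :: "real^6^6"
    by (simp add: vec_eq_iff matrix_matrix_mult_def mat_def if_distrib[of "\<lambda>x. x * _"]
        if_distrib[of "\<lambda>x. - x"] cong: if_cong)
  then have "pm_one #>\<^bsub>SL\<^esub> A = {A, - A}" for A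
    by (auto simp: r_coset_def SL_def pm_one_def)
  then show ?thesis
    by (auto simp: FactGroup_def RCOSETS_def SL_def)
qed

text \<open>The choice of a representative is harmless by \<open>coset_action_eq\<close>, since the
  two elements of a coset differ by a sign.\<close>

definition coset_action :: "(real^6^6) set \<times> int \<Rightarrow> split_quat^3^3 \<Rightarrow> split_quat^3^3"
  where "coset_action = (\<lambda>(C, k). rho ((SOME A. A \<in> C) ** twist k))"

lemma coset_action_eq:
  assumes C: "C \<in> carrier (SL Mod pm_one)" and A: "A \<in> C"
  shows "det A = 1" "coset_action (C, k) = rho (A ** twist k)"
proof -
  obtain A' where A': "det A' = 1" "C = {A', - A'}"
    using C SL_Mod_pm_one_iff by blast
  then show "det A = 1"
    using A by (auto simp: det_minus_6)
  have "(SOME B. B \<in> C) \<in> C"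
    using A by (rule someI)
  then have "(SOME B. B \<in> C) = A \<or> (SOME B. B \<in> C) = - A"
    using A unfolding A'(2) by auto
  moreover have "(- A) ** B = - (A ** B)" for B :: "real^6^6"
    by (simp add: vec_eq_iff matrix_matrix_mult_def sum_negf)
  ultimately show "coset_action (C, k) = rho (A ** twist k)"
    by (auto simp: coset_action_def rho_minus)
qed

theorem theorem5p3p4:
  shows "E6_split \<cong> semidirect_product ((SL :: (real^6^6) monoid) Mod pm_one) (integer_mod_group 2) nu_action"
proof -
  let ?Q = "(SL :: (real^6^6) monoid) Mod pm_one"
  let ?G = "semidirect_product ?Q (integer_mod_group 2) nu_action"
  have carrier: "(C, k) \<in> carrier ?G \<longleftrightarrow> C \<in> carrier ?Q \<and> (k = 0 \<or> k = 1)" for C k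
    by (auto simp: semidirect_product_def carrier_integer_mod_group)
  have dest: "\<exists>C k. x = (C, k) \<and> C \<in> carrier ?Q \<and> (k = 0 \<or> k = 1)" if "x \<in> carrier ?G" for x
    using that unfolding carrier[symmetric] by (cases x) simp
  have det: "det (A ** twist k) = (if k = 0 then 1 else - 1)" if "det A = 1" for A k
    using that by (simp add: det_mul twist_def det_reflection)
  have closed: "coset_action x \<in> carrier E6_split" if x': "x \<in> carrier ?G" for x
  proof -
    obtain C k where x: "x = (C, k)" "C \<in> carrier ?Q"
      using dest[OF x'] by blast
    then obtain A where A: "A \<in> C"
      unfolding SL_Mod_pm_one_iff by blast
    have "det (A ** twist k) = 1 \<or> det (A ** twist k) = - 1"
      using det[OF coset_action_eq(1)[OF x(2) A], of k] by (cases "k = 0") simp_all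
    then show ?thesis
      unfolding x(1) coset_action_eq(2)[OF x(2) A] by (rule rho_in_E6_split)
  qed
  have hom: "coset_action \<in> hom ?G E6_split"
  proof (rule homI[OF closed])
    fix x y assume xy: "x \<in> carrier ?G" "y \<in> carrier ?G"
    then obtain C k D l where x: "x = (C, k)" "C \<in> carrier ?Q" "k = 0 \<or> k = 1"
      and y: "y = (D, l)" "D \<in> carrier ?Q" "l = 0 \<or> l = 1"
      using dest[OF xy(1)] dest[OF xy(2)] by blast
    then obtain A B where A: "A \<in> C" and B: "B \<in> D"
      unfolding SL_Mod_pm_one_iff by blast
    have prod: "x \<otimes>\<^bsub>?G\<^esub> y = (C <#>\<^bsub>SL\<^esub> nu_action k D, (k + l) mod 2)"
      by (simp add: x(1) y(1) semidirect_product_def integer_mod_group_def)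
    have "(if k = 0 then B else nu B) \<in> nu_action k D"
      using B y(2) by (simp add: nu_action_def)
    with A have "A ** (if k = 0 then B else nu B) \<in> C <#>\<^bsub>SL\<^esub> nu_action k D"
      unfolding set_mult_def by (force simp: SL_def)
    moreover have "C <#>\<^bsub>SL\<^esub> nu_action k D \<in> carrier ?Q"
      using monoid.m_closed[OF group.is_monoid[OF group_semidirect_product_nu] xy] carrier
      unfolding prod by blast
    ultimately have "coset_action (x \<otimes>\<^bsub>?G\<^esub> y)
        = rho (A ** (if k = 0 then B else nu B) ** twist ((k + l) mod 2))"
      unfolding prod by (rule coset_action_eq(2)[rotated])
    \<comment> \<open>Moving \<open>twist k\<close> past \<open>B\<close> applies \<open>nu\<close>
      to \<open>B\<close> when \<open>k = 1\<close>; this is the twisted multiplication. The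
      reduction modulo 2 reflects that \<open>reflection\<close> is an involution.\<close>
    also have "A ** (if k = 0 then B else nu B) ** twist ((k + l) mod 2) = (A ** twist k) ** (B ** twist l)"
    proof (cases "k = 0")
      case False
      then have "k = 1"
        using x(3) by blast
      have "(A ** twist k) ** (B ** twist l) = A ** (reflection ** B) ** twist l"
        by (simp add: \<open>k = 1\<close> twist_def matrix_mul_assoc)
      also have "\<dots> = A ** nu B ** (reflection ** twist l)"
        by (simp add: reflection_mult[of B] matrix_mul_assoc)
      also have "reflection ** twist l = twist ((k + l) mod 2)"
        using y(3) \<open>k = 1\<close> by (auto simp: twist_def reflection_reflection)
      finally show ?thesis
        using \<open>k = 1\<close> by simp
    qed (use y(3) in \<open>auto simp: twist_def matrix_mul_assoc\<close>)
    also have "rho ((A ** twist k) ** (B ** twist l)) = coset_action x \<otimes>\<^bsub>E6_split\<^esub> coset_action y"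
      using closed[OF xy(1)] closed[OF xy(2)] x y A B
      by (simp add: mult_E6_split rho_mult coset_action_eq)
    finally show "coset_action (x \<otimes>\<^bsub>?G\<^esub> y) = coset_action x \<otimes>\<^bsub>E6_split\<^esub> coset_action y" .
  qed
  interpret group_hom ?G E6_split coset_action
    by (intro group_hom.intro group_hom_axioms.intro group_semidirect_product_nu group_E6_split hom)
  have "kernel ?G E6_split coset_action = {\<one>\<^bsub>?G\<^esub>}"
  proof (rule antisym; rule subsetI)
    fix x assume "x \<in> kernel ?G E6_split coset_action"
    then have x: "x \<in> carrier ?G" "coset_action x = (\<lambda>X\<in>J3. X)"
      by (simp_all add: kernel_def one_E6_split)
    then obtain C k where C: "x = (C, k)" "C \<in> carrier ?Q"
      using dest[OF x(1)] by blast
    then obtain A where A: "det A = 1" "C = {A, - A}"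
      unfolding SL_Mod_pm_one_iff by blast
    have "rho (A ** twist k) = (\<lambda>X\<in>J3. X)"
      using x(2) C coset_action_eq(2)[OF C(2), of A] A(2) by simp
    then have "det (A ** twist k) = 1" "A ** twist k = mat 1 \<or> A ** twist k = - mat 1"
      using rho_eq_one[of "A ** twist k"] det[OF A(1), of k] by (auto split: if_splits)
    \<comment> \<open>The determinant detects \<open>k\<close>: it would be -1 for a nontrivial
      twist.\<close>
    then have "k = 0" "A = mat 1 \<or> A = - mat 1"
      using det[OF A(1), of k] by (auto simp: twist_def split: if_splits)
    then have "x = (pm_one, 0)"
      using A(2) C(1) by (auto simp: pm_one_def)
    then show "x \<in> {\<one>\<^bsub>?G\<^esub>}"
      by (simp add: semidirect_product_def)
  qed (auto simp: kernel_def)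
  then have inj: "inj_on coset_action (carrier ?G)"
    by (simp add: inj_iff_trivial_ker)
  have "carrier E6_split \<subseteq> coset_action ` carrier ?G"
  proof
    fix \<alpha> assume "\<alpha> \<in> carrier E6_split"
    then obtain B where B: "det B = 1 \<or> det B = - 1" "\<alpha> = rho B"
      by (rule rho_surj)
    \<comment> \<open>The sign of \<open>det B\<close> dictates the twist; removing it leaves
      determinant one, and since \<open>twist k\<close> is its own inverse, multiplying by it again
      restores \<open>B\<close>.\<close>
    define k :: int where "k = (if det B = 1 then 0 else 1)"
    define A where "A = B ** twist k"
    have "det A = 1"
      using B(1) by (auto simp: A_def k_def twist_def det_mul det_reflection)
    then have C: "{A, - A} \<in> carrier ?Q"
      unfolding SL_Mod_pm_one_iff by blast
    have "twist k ** twist k = mat 1"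
      by (simp add: twist_def reflection_reflection)
    then have "A ** twist k = B"
      by (simp add: A_def flip: matrix_mul_assoc)
    then have "\<alpha> = coset_action ({A, - A}, k)"
      using coset_action_eq(2)[OF C, of A k] B(2) by simp
    moreover have "({A, - A}, k) \<in> carrier ?G"
      using C by (simp add: carrier k_def)
    ultimately show "\<alpha> \<in> coset_action ` carrier ?G"
      by blast
  qed
  with closed inj have "coset_action \<in> iso ?G E6_split"
    using hom by (auto simp: iso_def bij_betw_def)
  then show ?thesis
    using group.iso_sym[OF group_semidirect_product_nu] by (auto simp: is_iso_def)
qed

end
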